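(* Let $\mathrm{L}$ and $\mathbf{D}$ be a spline-admissible pair of order $r>d/2$ on $\mathbb{R}^d$, and for each $j\in\mathbb{Z}$ let $\Omega_j$ be a fundamental domain of $2\pi(\mathbf{D}^T)^{-j}\mathbb{Z}^d$ with associated exceptional set $F_j\subseteq\Omega_j$. Suppose the Lebesgue measure of $\bigcup_{j\in\mathbb{Z}}F_j$ is $0$. Then for any $j\in\mathbb{Z}$ and any $\bm{k}\in\mathbb{Z}^d\setminus\{\bm{0}\}$, $$\big(\psi_{n,j+1},\,\psi_{n,j+1}(\cdot-\mathbf{D}^j\bm{k})\big)_n\longrightarrow0\qquad\text{as }n\to\infty.$$
   Context: Conventions: $\widehat f(\bm{\omega})=\int_{\mathbb{R}^d}f(\bm{x})e^{-i\bm{x}\cdot\bm{\omega}}\,d\bm{x}$, $g^\vee$ is the inverse Fourier transform, $z^*$ denotes the complex conjugate. A Fourier multiplier operator $\mathrm{L}$ with measurable symbol $\widehat L$ acts by $\mathrm{L}f=(\widehat L\,\widehat f)^\vee$; its adjoint $\mathrm{L}^*$ has symbol $\widehat L^*$. $\mathrm{L}$ is admissible if $\widehat L=f/g$ with $f,g$ continuous functions on $\mathbb{R}^d$ such that the set of zeros of $fg$ has Lebesgue measure zero and the zero sets of $f$ and $g$ are disjoint. An operator $\mathrm{L}$ and an integer $d\times d$ matrix $\mathbf{D}$ are a spline-admissible pair of order $r>d/2$ if: (1) $\mathrm{L}$ is an admissible Fourier multiplier operator; (2) $\mathbf{D}=a\mathbf{R}$ with $\mathbf{R}$ orthogonal and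 $a>1$; (3) there is $C_{\mathrm{L}}>0$ with $C_{\mathrm{L}}(1+|\widehat L(\bm{\omega})|^2)\ge|\bm{\omega}|^{2r}$ for almost every $\bm{\omega}$; (4) for every $j\in\mathbb{Z}$ there is a periodic function $\widehat L_{\mathrm{d},j}(\bm{\omega})=\sum_{\bm{k}\in\mathbb{Z}^d}p_j[\bm{k}]e^{i\bm{\omega}\cdot\mathbf{D}^j\bm{k}}$ with $p_j\in\ell_1(\mathbb{Z}^d)$ such that $\widehat\varphi_j:=\widehat L_{\mathrm{d},j}\widehat L^{-1}$ satisfies, for some real constants $A_j,B_j$ and almost every $\bm{\omega}$, $$0<A_j\le\sum_{\bm{k}\in\mathbb{Z}^d}|\widehat\varphi_j(\bm{\omega}+2\pi(\mathbf{D}^T)^{-j}\bm{k})|^2\le B_j<\infty.$$ For pointwise considerations, a representative of $\widehat\varphi_j$ is fixed for which these bounds hold at every $\bm{\omega}$. For each integer $n\ge1$, $\mathrm{L}_n$ is the operator with symbol $\widehat L_n=\widehat L^n$, its generalized B-splines are given by $\widehat\varphi_{n,j}=\widehat\varphi_j^{\,n}$, and $$m_{n,j}(\bm{\omega})=\frac{|\widehat\varphi_j(\bm{\omega})|^{2n}}{\sum_{\bm{k}\in\mathbb{Z}^d}|\widehat\varphi_j(\bm{\omega}+2\pi(\mathbf{D}^T)^{-j}\bm{k})|^{2n}},\qquad\widehat\phi_{n,j}=|\det(\mathbf{D})|^j\,m_{n,j},\qquad\psi_{n,j+1}=\mathrm{L}_n^*\phi_{n,j}.$$ The semi-inner product is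 $(f,g)_n:=\int_{\mathbb{R}^d}\widehat f\,\widehat g^{\,*}\,|\widehat L_n|^{-2}$. A fundamental domain of $2\pi(\mathbf{D}^T)^{-j}\mathbb{Z}^d$ is a bounded measurable set $\Omega_j$ with $\sum_{\bm{k}\in\mathbb{Z}^d}\chi_{\Omega_j}(\bm{x}+2\pi(\mathbf{D}^T)^{-j}\bm{k})=1$ for all $\bm{x}$. For $\bm{x}\in\Omega_j$ let $E_{j,\bm{x}}=\{\bm{x}+2\pi(\mathbf{D}^T)^{-j}\bm{k}:\bm{k}\in\mathbb{Z}^d\}$. $F_j$ is the set of $\bm{x}\in\Omega_j$ for which there is not a unique $\bm{y}\in E_{j,\bm{x}}$ where $m_{1,j}$ attains its maximum over $E_{j,\bm{x}}$; i.e. $\bm{x}\in\Omega_j\setminus F_j$ iff there is $\bm{y}\in E_{j,\bm{x}}$ with $m_{1,j}(\bm{y})>m_{1,j}(\bm{y}+2\pi(\mathbf{D}^T)^{-j}\bm{k})$ for all $\bm{k}\ne\bm{0}$. *)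

theory Defs
  imports "HOL-Analysis.Analysis"
begin

section \<open>Integer vectors, powers of the dilation matrix, lattices\<close>

definition real_vec :: "int ^ 'd \<Rightarrow> real ^ 'd" where
  "real_vec k = (\<chi> i. of_int (k $ i))"

definition real_mat :: "int ^ 'd ^ 'd \<Rightarrow> real ^ 'd ^ 'd" where
  "real_mat D = map_matrix of_int D"

text \<open>The library operation \<open>^\<close> on vectors of vectors is componentwise, so powers with
  respect to the matrix product are introduced here, with integer exponents.\<close>

definition matrix_powi :: "real ^ 'd ^ 'd \<Rightarrow> int \<Rightarrow> real ^ 'd ^ 'd" where
  "matrix_powi M j =
     (if j \<ge> 0 then (((**) M) ^^ nat j) (mat 1)
      else (((**) (matrix_inv M)) ^^ nat (- j)) (mat 1))"

text \<open>The points \<open>D\<^sup>j k\<close> and \<open>2 \<pi> (D\<^sup>T)\<^sup>-\<^sup>j k\<close>.\<close>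

definition space_pt :: "int ^ 'd ^ 'd \<Rightarrow> int \<Rightarrow> int ^ 'd \<Rightarrow> real ^ 'd" where
  "space_pt D j k = matrix_powi (real_mat D) j *v real_vec k"

definition freq_pt :: "int ^ 'd ^ 'd \<Rightarrow> int \<Rightarrow> int ^ 'd \<Rightarrow> real ^ 'd" where
  "freq_pt D j k = (2 * pi) *\<^sub>R (matrix_powi (transpose (real_mat D)) (- j) *v real_vec k)"


section \<open>The Fourier transform on \<open>L\<^sup>2\<close> and Fourier multipliers\<close>

definition sq_integrable :: "(real ^ 'd \<Rightarrow> complex) \<Rightarrow> bool" where
  "sq_integrable f \<longleftrightarrow>
     f \<in> borel_measurable lebesgue \<and> integrable lebesgue (\<lambda>x. (norm (f x))\<^sup>2)"

definition fourier_integral :: "(real ^ 'd \<Rightarrow> complex) \<Rightarrow> real ^ 'd \<Rightarrow> complex" where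
  "fourier_integral f \<omega> = (LINT x|lebesgue. f x * exp (- \<i> * of_real (x \<bullet> \<omega>)))"

definition L2_tendsto :: "(nat \<Rightarrow> real ^ 'd \<Rightarrow> complex) \<Rightarrow> (real ^ 'd \<Rightarrow> complex) \<Rightarrow> bool" where
  "L2_tendsto g f \<longleftrightarrow>
     (\<lambda>i. \<integral>\<^sup>+ x. ennreal ((norm (g i x - f x))\<^sup>2) \<partial>lebesgue) \<longlonglongrightarrow> 0"

text \<open>\<open>F\<close> represents the Fourier transform of \<open>f\<close> in \<open>L\<^sup>2\<close>: the integral formula on
  \<open>L\<^sup>1 \<inter> L\<^sup>2\<close>, extended by density and continuity. It determines \<open>F\<close> up to a null set.\<close>

definition has_fourier :: "(real ^ 'd \<Rightarrow> complex) \<Rightarrow> (real ^ 'd \<Rightarrow> complex) \<Rightarrow> bool" where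
  "has_fourier f F \<longleftrightarrow>
     sq_integrable f \<and> sq_integrable F \<and>
     (\<exists>g. (\<forall>i. integrable lebesgue (g i) \<and> sq_integrable (g i)) \<and>
          L2_tendsto g f \<and> L2_tendsto (\<lambda>i. fourier_integral (g i)) F)"

definition fourier :: "(real ^ 'd \<Rightarrow> complex) \<Rightarrow> real ^ 'd \<Rightarrow> complex" where
  "fourier f = (SOME F. has_fourier f F)"

text \<open>\<open>h\<close> is the image of \<open>f\<close> under the Fourier multiplier operator with symbol \<open>M\<close>.\<close>

definition multiplier_image ::
    "(real ^ 'd \<Rightarrow> complex) \<Rightarrow> (real ^ 'd \<Rightarrow> complex) \<Rightarrow> (real ^ 'd \<Rightarrow> complex) \<Rightarrow> bool" where
  "multiplier_image M f h \<longleftrightarrow>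
     (\<exists>F. has_fourier f F \<and> has_fourier h (\<lambda>\<omega>. M \<omega> * F \<omega>))"

definition symbol_pow :: "(real ^ 'd \<Rightarrow> complex) \<Rightarrow> nat \<Rightarrow> real ^ 'd \<Rightarrow> complex" where
  "symbol_pow L n = (\<lambda>\<omega>. L \<omega> ^ n)"

definition adjoint_symbol :: "(real ^ 'd \<Rightarrow> complex) \<Rightarrow> real ^ 'd \<Rightarrow> complex" where
  "adjoint_symbol L = (\<lambda>\<omega>. cnj (L \<omega>))"

definition semi_inner ::
    "(real ^ 'd \<Rightarrow> complex) \<Rightarrow> (real ^ 'd \<Rightarrow> complex) \<Rightarrow> (real ^ 'd \<Rightarrow> complex) \<Rightarrow> complex" where
  "semi_inner L f g =
     (LINT \<omega>|lebesgue. fourier f \<omega> * cnj (fourier g \<omega>) / of_real ((norm (L \<omega>))\<^sup>2))"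


section \<open>Spline-admissible pairs\<close>

text \<open>Symbols matter only up to null sets, and the zero set of \<open>g\<close> is null.\<close>

definition admissible_symbol :: "(real ^ 'd \<Rightarrow> complex) \<Rightarrow> bool" where
  "admissible_symbol L \<longleftrightarrow>
     L \<in> borel_measurable lebesgue \<and>
     (\<exists>f g. continuous_on UNIV f \<and> continuous_on UNIV g \<and>
        {\<omega>. f \<omega> * g \<omega> = 0} \<in> null_sets lebesgue \<and>
        {\<omega>. f \<omega> = 0} \<inter> {\<omega>. g \<omega> = 0} = {} \<and>
        (AE \<omega> in lebesgue. L \<omega> = f \<omega> / g \<omega>))"

definition scaled_orthogonal :: "int ^ 'd ^ 'd \<Rightarrow> bool" where
  "scaled_orthogonal D \<longleftrightarrow>
     (\<exists>a R. a > 1 \<and> orthogonal_matrix R \<and> real_mat D = a *\<^sub>R R)"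

definition discrete_symbol ::
    "int ^ 'd ^ 'd \<Rightarrow> int \<Rightarrow> (int ^ 'd \<Rightarrow> complex) \<Rightarrow> real ^ 'd \<Rightarrow> complex" where
  "discrete_symbol D j p \<omega> =
     (\<Sum>\<^sub>\<infinity>k\<in>UNIV. p k * exp (\<i> * of_real (\<omega> \<bullet> space_pt D j k)))"

definition lattice_bounds ::
    "int ^ 'd ^ 'd \<Rightarrow> int \<Rightarrow> real \<Rightarrow> real \<Rightarrow> (real ^ 'd \<Rightarrow> complex) \<Rightarrow> real ^ 'd \<Rightarrow> bool" where
  "lattice_bounds D j A B h \<omega> \<longleftrightarrow>
     (\<lambda>k. (norm (h (\<omega> + freq_pt D j k)))\<^sup>2) summable_on UNIV \<and>
     A \<le> (\<Sum>\<^sub>\<infinity>k\<in>UNIV. (norm (h (\<omega> + freq_pt D j k)))\<^sup>2) \<and>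
     (\<Sum>\<^sub>\<infinity>k\<in>UNIV. (norm (h (\<omega> + freq_pt D j k)))\<^sup>2) \<le> B"

definition localization ::
    "(real ^ 'd \<Rightarrow> complex) \<Rightarrow> int ^ 'd ^ 'd \<Rightarrow> int \<Rightarrow> (int ^ 'd \<Rightarrow> complex) \<Rightarrow>
      real \<Rightarrow> real \<Rightarrow> bool" where
  "localization L D j p A B \<longleftrightarrow>
     (\<lambda>k. norm (p k)) summable_on UNIV \<and> 0 < A \<and>
     (AE \<omega> in lebesgue. lattice_bounds D j A B (\<lambda>\<xi>. discrete_symbol D j p \<xi> / L \<xi>) \<omega>)"

definition spline_admissible ::
    "(real ^ 'd \<Rightarrow> complex) \<Rightarrow> int ^ 'd ^ 'd \<Rightarrow> real \<Rightarrow> bool" where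
  "spline_admissible L D r \<longleftrightarrow>
     r > real CARD('d) / 2 \<and>
     admissible_symbol L \<and>
     scaled_orthogonal D \<and>
     (\<exists>C>0. AE \<omega> in lebesgue. C * (1 + (norm (L \<omega>))\<^sup>2) \<ge> norm \<omega> powr (2 * r)) \<and>
     (\<forall>j. \<exists>p A B. localization L D j p A B)"

text \<open>\<open>\<Phi>\<close> is a representative of \<open>discrete_symbol D j p / L\<close> that satisfies the lattice
  bounds at every point.\<close>

definition bspline_symbol ::
    "(real ^ 'd \<Rightarrow> complex) \<Rightarrow> int ^ 'd ^ 'd \<Rightarrow> int \<Rightarrow> (int ^ 'd \<Rightarrow> complex) \<Rightarrow>
      real \<Rightarrow> real \<Rightarrow> (real ^ 'd \<Rightarrow> complex) \<Rightarrow> bool" where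
  "bspline_symbol L D j p A B \<Phi> \<longleftrightarrow>
     (AE \<omega> in lebesgue. \<Phi> \<omega> = discrete_symbol D j p \<omega> / L \<omega>) \<and>
     (\<forall>\<omega>. lattice_bounds D j A B \<Phi> \<omega>)"


section \<open>The functions \<open>m\<^sub>n\<^sub>,\<^sub>j\<close> and the exceptional sets\<close>

definition m_fun ::
    "int ^ 'd ^ 'd \<Rightarrow> int \<Rightarrow> (real ^ 'd \<Rightarrow> complex) \<Rightarrow> nat \<Rightarrow> real ^ 'd \<Rightarrow> real" where
  "m_fun D j \<Phi> n \<omega> =
     (norm (\<Phi> \<omega>)) ^ (2 * n) / (\<Sum>\<^sub>\<infinity>k\<in>UNIV. (norm (\<Phi> (\<omega> + freq_pt D j k))) ^ (2 * n))"

definition fundamental_domain :: "int ^ 'd ^ 'd \<Rightarrow> int \<Rightarrow> (real ^ 'd) set \<Rightarrow> bool" where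
  "fundamental_domain D j \<Omega> \<longleftrightarrow>
     bounded \<Omega> \<and> \<Omega> \<in> sets lebesgue \<and>
     (\<forall>x. ((\<lambda>k. indicator \<Omega> (x + freq_pt D j k)) has_sum (1::real)) UNIV)"

definition freq_orbit :: "int ^ 'd ^ 'd \<Rightarrow> int \<Rightarrow> real ^ 'd \<Rightarrow> (real ^ 'd) set" where
  "freq_orbit D j x = range (\<lambda>k. x + freq_pt D j k)"

definition exceptional_set ::
    "int ^ 'd ^ 'd \<Rightarrow> int \<Rightarrow> (real ^ 'd \<Rightarrow> complex) \<Rightarrow> (real ^ 'd) set \<Rightarrow> (real ^ 'd) set" where
  "exceptional_set D j \<Phi> \<Omega> =
     {x \<in> \<Omega>. \<not> (\<exists>y \<in> freq_orbit D j x. \<forall>k. k \<noteq> 0 \<longrightarrow>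
                m_fun D j \<Phi> 1 y > m_fun D j \<Phi> 1 (y + freq_pt D j k))}"

end

theory Submission
  imports Defs "HOL-Probability.Sinc_Integral"
begin

text \<open>
  On the Fourier side the statement concerns a partition of unity that sharpens into tiles.
  The transform of \<open>\<psi> n (j + 1)\<close> is a constant times the conjugate of \<open>L\<^sup>n\<close> times
  \<open>m\<^sub>n = m_fun D j (\<Phi> j) n\<close>, and the weight \<open>\<bar>L\<^sup>n\<bar>\<^sup>-\<^sup>2\<close> of the semi-inner product cancels
  the symbol. With \<open>a = D\<^sup>j k\<close>, the semi-inner product is therefore a constant, independent of \<open>n\<close>, times
  \<open>\<integral> e\<^sup>i\<^sup>\<omega>\<^sup>\<cdot>\<^sup>a m\<^sub>n(\<omega>)\<^sup>2 d\<omega>\<close> (\<open>semi_inner_translate\<close>).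

  The translates of \<open>m\<^sub>n\<close> along the lattice \<open>2 \<pi> (D\<^sup>T)\<^sup>-\<^sup>j \<int>\<^sup>d\<close> sum to 1, and the character
  \<open>e\<^sup>i\<^sup>\<omega>\<^sup>\<cdot>\<^sup>a\<close> is periodic along this lattice and not constant. Hence \<open>\<integral> e\<^sup>i\<^sup>\<omega>\<^sup>\<cdot>\<^sup>a m\<^sub>n = 0\<close>
  (\<open>integral_char_eq_0\<close>), just as the integral of the character over a fundamental domain
  vanishes. The difference between \<open>m\<^sub>n\<close> and \<open>m\<^sub>n\<^sup>2\<close> is controlled by \<open>\<integral> (m\<^sub>n - m\<^sub>n\<^sup>2)\<close>. Folded
  into the fundamental domain, its integrand is bounded by 1. At a point whose orbit has a
  unique maximizer of \<open>m\<^sub>1\<close>, the power \<open>n\<close> concentrates the partition of unity at this maximizer,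
  where \<open>m\<^sub>n\<close> tends to 1, so the folded integrand tends to 0 (\<open>m_fun_peak_tendsto_1\<close>). Almost
  every point is of this kind, and dominated convergence finishes the argument
  (\<open>integral_defect_tendsto_0\<close>).

  The Fourier transform here is a limit in \<open>L\<^sup>2\<close>, and \<open>fourier\<close> picks one representative. The first
  reduction thus rests on two facts about such limits: they are unique up to null sets
  (\<open>has_fourier_unique\<close>), and they turn translations into characters (\<open>has_fourier_translate\<close>).
  For uniqueness, the integral of a transform \<open>F\<close> of \<open>f\<close> over a box equals the integral of \<open>f\<close>
  against the transform of the box, which is square integrable by an explicit computation; so all
  transforms of \<open>f\<close> have the same integrals over boxes.
\<close>

section \<open>Fourier integrals\<close>

lemma sigma_finite_lebesgue: "sigma_finite_measure (lebesgue :: 'a::euclidean_space measure)"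
proof
  show "\<exists>A::'a set set. countable A \<and> A \<subseteq> sets lebesgue \<and> \<Union>A = space lebesgue \<and>
          (\<forall>a\<in>A. emeasure lebesgue a \<noteq> \<infinity>)"
    by (intro exI[of _ "range (\<lambda>n::nat. box (- real n *\<^sub>R One) (real n *\<^sub>R One))"])
       (auto simp: emeasure_lborel_box_eq UN_box_eq_UNIV)
qed

interpretation lebesgue_pair:
  pair_sigma_finite "lebesgue :: ('a::euclidean_space) measure" "lebesgue :: ('a::euclidean_space) measure"
  by (simp add: pair_sigma_finite_def sigma_finite_lebesgue)

text \<open>The multiplier by which a translation by \<open>a\<close> acts on the Fourier side. The
  expression is symmetric in its arguments, and \<open>wave \<omega> x\<close> is also the kernel of the Fourier
  integral.\<close>
definition wave :: "real ^ 'd \<Rightarrow> real ^ 'd \<Rightarrow> complex" where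
  "wave a x = exp (- \<i> * of_real (x \<bullet> a))"

lemma norm_wave [simp]: "norm (wave a x) = 1"
  by (simp add: wave_def)

lemma wave_add: "wave a (x + y) = wave a x * wave a y"
  by (simp add: wave_def inner_add_left distrib_left mult_exp_exp algebra_simps)

lemma wave_borel_measurable [measurable]: "wave a \<in> borel_measurable borel"
  unfolding wave_def by (intro borel_measurable_continuous_onI continuous_intros)

lemma wave_measurable [measurable]: "wave a \<in> borel_measurable lebesgue"
  by (rule measurable_completion) simp

lemma wave_measurable_pair:
  "(\<lambda>(x::real^'d,\<omega>). wave \<omega> x) \<in> borel_measurable (lebesgue \<Otimes>\<^sub>M lebesgue)"
proof -
  have id: "(\<lambda>x. x) \<in> lebesgue \<rightarrow>\<^sub>M (borel :: (real^'d) measure)"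
    by (rule measurable_completion) simp
  have [measurable]: "fst \<in> (lebesgue \<Otimes>\<^sub>M lebesgue) \<rightarrow>\<^sub>M (borel :: (real^'d) measure)"
     "snd \<in> (lebesgue \<Otimes>\<^sub>M lebesgue) \<rightarrow>\<^sub>M (borel :: (real^'d) measure)"
    using measurable_compose[OF measurable_fst id] measurable_compose[OF measurable_snd id]
    by (auto simp: eta_contract_eq)
  show ?thesis
    unfolding wave_def split_beta by measurable
qed

lemma fourier_integral_wave: "fourier_integral f \<omega> = (LINT x|lebesgue. f x * wave \<omega> x)"
  by (simp add: fourier_integral_def wave_def)

lemma fourier_integral_measurable:
  fixes f :: "real^'d \<Rightarrow> complex"
  assumes [measurable]: "f \<in> borel_measurable lebesgue"
  shows "fourier_integral f \<in> borel_measurable lebesgue"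
proof -
  note wave_measurable_pair[measurable]
  have "(\<lambda>(\<omega>,x). f x * wave \<omega> x) \<in> borel_measurable (lebesgue \<Otimes>\<^sub>M lebesgue)"
    using measurable_compose[OF measurable_pair_swap' wave_measurable_pair]
    by (simp add: split_beta)
  then show ?thesis
    unfolding fourier_integral_wave[abs_def]
    by (rule sigma_finite_measure.borel_measurable_lebesgue_integral[OF sigma_finite_lebesgue])
qed

lemma norm_fourier_integral_le:
  "norm (fourier_integral f \<omega>) \<le> (LINT x|lebesgue. norm (f x))"
  unfolding fourier_integral_wave
  by (rule order_trans[OF integral_norm_bound]) (simp add: norm_mult)

text \<open>Fubini for the symmetric kernel \<open>wave \<omega> x\<close>. This identity moves the Fourier integral onto
  a test function, so that limits can be taken on the space side.\<close>
lemma integral_fourier_mult_swap: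
  fixes f h :: "real^'d \<Rightarrow> complex"
  assumes f: "integrable lebesgue f" and h: "integrable lebesgue h"
  shows "(LINT \<omega>|lebesgue. fourier_integral f \<omega> * h \<omega>) = (LINT x|lebesgue. f x * fourier_integral h x)"
proof -
  have [measurable]: "f \<in> borel_measurable lebesgue" "h \<in> borel_measurable lebesgue"
    using f h by auto
  note wave_measurable_pair[measurable]
  let ?k = "\<lambda>(x,\<omega>). f x * h \<omega> * wave \<omega> x"
  have m: "?k \<in> borel_measurable (lebesgue \<Otimes>\<^sub>M lebesgue)"
    using wave_measurable_pair by (simp add: split_beta)
  have "integrable (lebesgue \<Otimes>\<^sub>M lebesgue) ?k"
  proof (rule lebesgue_pair.Fubini_integrable[OF m])
    show "integrable lebesgue (\<lambda>x. \<integral>y. norm (?k (x, y)) \<partial>lebesgue)"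
      using f h by (simp add: norm_mult)
    show "AE x in lebesgue. integrable lebesgue (\<lambda>y. ?k (x, y))"
    proof (rule AE_I2, simp)
      fix x
      have "integrable lebesgue (\<lambda>y. f x * h y)" using h by simp
      moreover have "wave y x = wave x y" for y by (simp add: wave_def inner_commute)
      ultimately show "integrable lebesgue (\<lambda>y. f x * h y * wave y x)"
        by (rule_tac Bochner_Integration.integrable_bound) (auto simp: norm_mult)
    qed
  qed
  from lebesgue_pair.Fubini_integral[OF this]
  have "(\<integral>y. \<integral>x. f x * h y * wave y x \<partial>lebesgue \<partial>lebesgue)
      = (\<integral>x. \<integral>y. f x * h y * wave y x \<partial>lebesgue \<partial>lebesgue)"
    by simp
  moreover have "(\<integral>x. f x * h y * wave y x \<partial>lebesgue) = fourier_integral f y * h y" for y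
    unfolding fourier_integral_wave 
    by (subst integral_mult_left_zero[symmetric]) (simp add: mult_ac)
  moreover have "(\<integral>y. f x * h y * wave y x \<partial>lebesgue) = f x * fourier_integral h x" for x
    unfolding fourier_integral_wave 
    by (subst integral_mult_right_zero[symmetric]) (simp add: mult_ac wave_def inner_commute)
  ultimately show ?thesis by simp
qed

section \<open>Square integrable transforms of boxes\<close>

lemma integral_lborel_prod:
  fixes f :: "'a::euclidean_space \<Rightarrow> real \<Rightarrow> complex"
  assumes int: "\<And>b. b \<in> Basis \<Longrightarrow> integrable lborel (f b)"
  shows "(\<integral>x. (\<Prod>b\<in>Basis. f b (x \<bullet> b)) \<partial>lborel) = (\<Prod>b\<in>Basis. (\<integral>t. f b t \<partial>lborel))"
proof -
  interpret product_sigma_finite "\<lambda>_::'a. interval_measure (\<lambda>x. x)"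
    by (intro product_sigma_finite.intro sigma_finite_interval_measure) auto
  have [measurable]: "f b \<in> borel_measurable borel" if "b \<in> Basis" for b
    using int[OF that] by auto
  have "(\<integral>x. (\<Prod>b\<in>Basis. f b (x \<bullet> b)) \<partial>lborel) =
     (\<integral>x. (\<Prod>b\<in>Basis. f b (x b)) \<partial>(\<Pi>\<^sub>M b\<in>Basis. interval_measure (\<lambda>x. x)))"
    by (simp add: lborel_def[where 'a='a] integral_distr)
  also have "\<dots> = (\<Prod>b\<in>Basis. integral\<^sup>L (interval_measure (\<lambda>x. x)) (f b))"
    using int by (intro product_integral_prod) (auto simp: lborel_eq_real)
  finally show ?thesis by (simp add: lborel_eq_real)
qed

text \<open>The integral is at most \<open>b - a\<close> because the integrand has modulus one, and at most
  \<open>2 / \<bar>t\<bar>\<close> for \<open>t \<noteq> 0\<close> by explicit integration; the two bounds together give quadratic decay of the square.\<close>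
lemma interval_wave_bound:
  fixes a b t :: real
  defines "I \<equiv> (\<integral>s. indicator {a<..<b} s * exp (- \<i> * of_real (s * t)) \<partial>lborel)"
  shows "(norm I)\<^sup>2 \<le> ((b - a)\<^sup>2 + 4) * inverse (1 + t\<^sup>2)"
proof (cases "a \<le> b")
  case False
  then have "I = 0" by (simp add: I_def)
  then show ?thesis by (simp add: add_nonneg_nonneg)
next
  case ab: True
  let ?F = "\<lambda>s. indicator {a..b} s *\<^sub>R exp (- \<i> * of_real (s * t))"
  have I: "I = (\<integral>s. ?F s \<partial>lborel)"
    unfolding I_def
  proof (rule integral_cong_AE)
    show "AE s in lborel. indicator {a<..<b} s * exp (- \<i> * of_real (s * t)) = ?F s"
      using AE_lborel_singleton[of a] AE_lborel_singleton[of b]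
      by eventually_elim (auto split: split_indicator)
  qed auto
  have 1: "norm I \<le> b - a"
  proof -
    have "norm I \<le> (\<integral>s. indicator {a..b} s \<partial>lborel)"
      unfolding I by (rule order_trans[OF integral_norm_bound]) simp
    then show ?thesis using ab by simp
  qed
  have 2: "\<bar>t\<bar> * norm I \<le> 2"
  proof (cases "t = 0")
    case False
    let ?G = "\<lambda>s. exp (- \<i> * of_real (s * t)) / (- \<i> * of_real t)"
    have "I = ?G b - ?G a"
      unfolding I
    proof (rule integral_FTC_Icc[OF ab])
      fix s
      have "((\<lambda>s. exp (s * (- \<i> * of_real t)) / (- \<i> * of_real t)) has_field_derivative
              exp (of_real s * (- \<i> * of_real t))) (at (of_real s))"
        using False by (auto intro!: derivative_eq_intros)
      from has_vector_derivative_real_field[OF this, of "{a..b}"]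
      show "(?G has_vector_derivative exp (- \<i> * of_real (s * t))) (at s within {a..b})"
        by (simp add: mult_ac)
    qed (intro continuous_intros)
    then have "norm I * \<bar>t\<bar> = norm (exp (- \<i> * of_real (b * t)) - exp (- \<i> * of_real (a * t)))"
      using False by (simp add: diff_divide_distrib[symmetric] norm_divide norm_mult norm_minus_commute
          del: of_real_mult)
    also have "\<dots> \<le> 1 + 1"
      by (rule order_trans[OF norm_triangle_ineq4]) simp
    finally show ?thesis by (simp add: mult.commute)
  qed simp
  have "(norm I)\<^sup>2 * (1 + t\<^sup>2) = (norm I)\<^sup>2 + (\<bar>t\<bar> * norm I)\<^sup>2"
    by (simp add: power_mult_distrib algebra_simps)
  also have "\<dots> \<le> (b - a)\<^sup>2 + 2\<^sup>2"
    using 1 2 by (intro add_mono power_mono) auto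
  finally show ?thesis
    by (simp add: field_simps add_pos_nonneg)
qed

lemma nn_integral_inverse_1_plus_square_finite:
  "(\<integral>\<^sup>+t. ennreal (inverse (1 + t\<^sup>2)) \<partial>lborel) < \<infinity>"
proof -
  have "integrable lborel (\<lambda>t::real. inverse (1 + t\<^sup>2))"
    using integrable_inverse_1_plus_square
    by (simp add: set_integrable_def einterval_def)
  then show ?thesis
    by (simp add: integrable_iff_bounded)
qed

text \<open>The transform of a box is a product of one-dimensional integrals, each of which has
  an integrable square by the decay bound, so boxes can serve as test functions without
  appeal to the Plancherel theorem.\<close>
lemma sq_integrable_fourier_integral_box:
  fixes a b :: "real^'d"
  shows "sq_integrable (fourier_integral (indicator (box a b)))"
proof -
  have meas: "fourier_integral (indicator (box a b)) \<in> borel_measurable (lebesgue :: (real^'d) measure)"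
    by (rule fourier_integral_measurable, rule borel_measurable_indicator) simp
  define I where "I e t = (\<integral>s. indicator {a \<bullet> e<..<b \<bullet> e} s * exp (- \<i> * of_real (s * t)) \<partial>lborel)"
    for e :: "real^'d" and t
  have prod: "fourier_integral (indicator (box a b)) x = (\<Prod>e\<in>Basis. I e (x \<bullet> e))" for x :: "real^'d"
  proof -
    have "fourier_integral (indicator (box a b)) x = (LINT \<omega>|lborel. indicator (box a b) \<omega> * wave x \<omega>)"
      unfolding fourier_integral_wave by (rule integral_completion) simp
    also have "\<dots> = (LINT \<omega>|lborel. (\<Prod>e\<in>Basis. indicator {a \<bullet> e<..<b \<bullet> e} (\<omega> \<bullet> e) *
        exp (- \<i> * of_real ((\<omega> \<bullet> e) * (x \<bullet> e)))))"
    proof (rule Bochner_Integration.integral_cong[OF refl])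
      fix \<omega> :: "real^'d"
      have "wave x \<omega> = (\<Prod>e\<in>Basis. exp (- \<i> * of_real ((\<omega> \<bullet> e) * (x \<bullet> e))))"
        unfolding wave_def by (subst euclidean_inner) (simp add: exp_sum sum_distrib_left sum_negf[symmetric])
      moreover have "indicator (box a b) \<omega> = (\<Prod>e\<in>Basis. indicator {a \<bullet> e<..<b \<bullet> e} (\<omega> \<bullet> e) :: complex)"
        by (auto simp: box_def split: split_indicator)
      ultimately show "indicator (box a b) \<omega> * wave x \<omega> =
          (\<Prod>e\<in>Basis. indicator {a \<bullet> e<..<b \<bullet> e} (\<omega> \<bullet> e) * exp (- \<i> * of_real ((\<omega> \<bullet> e) * (x \<bullet> e))))"
        by (simp add: prod.distrib)
    qed
    also have "\<dots> = (\<Prod>e\<in>Basis. I e (x \<bullet> e))"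
      unfolding I_def
    proof (rule integral_lborel_prod)
      fix e :: "real^'d"
      have "integrable lborel (\<lambda>s. indicator {a \<bullet> e<..<b \<bullet> e} s :: real)"
        by (rule integrable_real_indicator) (auto simp: emeasure_lborel_box_eq[where 'a=real, unfolded box_real])
      then show "integrable lborel (\<lambda>s. indicator {a \<bullet> e<..<b \<bullet> e} s * exp (- \<i> * of_real (s * (x \<bullet> e))))"
        by (rule Bochner_Integration.integrable_bound) (auto simp: norm_mult indicator_def)
    qed
    finally show ?thesis .
  qed
  define C where "C e = ((b \<bullet> e - a \<bullet> e)\<^sup>2 + 4)" for e
  have "(\<integral>\<^sup>+x. ennreal ((norm (fourier_integral (indicator (box a b)) x))\<^sup>2) \<partial>(lebesgue :: (real^'d) measure))
     = (\<integral>\<^sup>+x. ennreal ((norm (fourier_integral (indicator (box a b)) x))\<^sup>2) \<partial>lborel)"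
    by (rule nn_integral_completion)
  also have "\<dots> \<le> (\<integral>\<^sup>+x. (\<Prod>e\<in>Basis. ennreal (C e * inverse (1 + (x \<bullet> e)\<^sup>2))) \<partial>lborel)"
  proof (rule nn_integral_mono)
    fix x :: "real^'d"
    have "(norm (fourier_integral (indicator (box a b)) x))\<^sup>2 = (\<Prod>e\<in>Basis. (norm (I e (x \<bullet> e)))\<^sup>2)"
      by (simp add: prod prod_norm[symmetric] prod_power_distrib)
    also have "\<dots> \<le> (\<Prod>e\<in>Basis. C e * inverse (1 + (x \<bullet> e)\<^sup>2))"
      unfolding I_def C_def by (intro prod_mono conjI interval_wave_bound zero_le_power2)
    finally show "ennreal ((norm (fourier_integral (indicator (box a b)) x))\<^sup>2)
        \<le> (\<Prod>e\<in>Basis. ennreal (C e * inverse (1 + (x \<bullet> e)\<^sup>2)))"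
      by (subst prod_ennreal) (auto simp: C_def intro!: ennreal_leI)
  qed
  also have "\<dots> = (\<Prod>e\<in>Basis. (\<integral>\<^sup>+t. ennreal (C e * inverse (1 + t\<^sup>2)) \<partial>lborel))"
    by (rule nn_integral_lborel_prod) auto
  also have "\<dots> < \<infinity>"
  proof -
    have "(\<integral>\<^sup>+t. ennreal (C e * inverse (1 + t\<^sup>2)) \<partial>lborel) < \<infinity>" for e
      using nn_integral_inverse_1_plus_square_finite
      by (subst ennreal_mult) (auto simp: C_def nn_integral_cmult ennreal_mult_less_top)
    then show ?thesis
      by (auto simp: less_top[symmetric] ennreal_prod_eq_top)
  qed
  finally show ?thesis
    using meas by (simp add: sq_integrable_def integrable_iff_bounded)
qed

section \<open>Functions with vanishing integrals over boxes\<close>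

text \<open>Boxes form an intersection-stable generator of the Borel sets, and the sets over which
  \<open>f\<close> integrates to zero form a Dynkin system.\<close>
lemma AE_zero_if_integral_boxes_zero:
  fixes f :: "'a::euclidean_space \<Rightarrow> real"
  assumes f: "integrable lborel f"
    and boxes: "\<And>a b. (\<integral>x. indicator (box a b) x * f x \<partial>lborel) = 0"
  shows "AE x in lborel. f x = 0"
proof -
  let ?E = "range (\<lambda>(a, b::'a). box a b)"
  have [measurable]: "f \<in> borel_measurable borel" using f by auto
  have ind: "integrable lborel (\<lambda>x. indicator A x * f x)" if "A \<in> sets borel" for A
    using integrable_mult_indicator[of A lborel f] f that by simp
  have E_Pow: "?E \<subseteq> Pow UNIV" by simp
  have Int_stable_boxes: "Int_stable ?E"
    by (auto simp: Int_stable_def box_Int_box)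
  have zero: "(\<integral>x. indicator A x * f x \<partial>lborel) = 0" if "A \<in> sigma_sets UNIV ?E" for A
    using Int_stable_boxes E_Pow that
  proof (induction rule: sigma_sets_induct_disjoint)
    fix A assume "A \<in> ?E" then show "(\<integral>x. indicator A x * f x \<partial>lborel) = 0"
      using boxes by auto
  next
    show "(\<integral>x. indicator {} x * f x \<partial>lborel) = 0" by simp
  next
    fix A assume A: "A \<in> sigma_sets UNIV ?E" and IH: "(\<integral>x. indicator A x * f x \<partial>lborel) = 0"
    have Ab: "A \<in> sets borel" using A by (simp add: borel_eq_box sets_measure_of)
    \<comment> \<open>The whole space is an increasing union of boxes, so the total integral vanishes as well.\<close>
    have "(\<lambda>n. \<integral>x. indicator (box (- (real n *\<^sub>R One)) (real n *\<^sub>R One)) x * f x \<partial>lborel)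
        \<longlonglongrightarrow> (\<integral>x. f x \<partial>lborel)"
    proof (rule integral_dominated_convergence[where w = "\<lambda>x. norm (f x)"])
      show "AE x in lborel. (\<lambda>n. indicator (box (- (real n *\<^sub>R One)) (real n *\<^sub>R One)) x * f x) \<longlonglongrightarrow> f x"
      proof (rule AE_I2)
        fix x :: 'a
        obtain N where N: "x \<in> box (- (real N *\<^sub>R One)) (real N *\<^sub>R One)"
          using UN_box_eq_UNIV by blast
        have "\<forall>\<^sub>F n in sequentially. indicator (box (- (real n *\<^sub>R One)) (real n *\<^sub>R One)) x * f x = f x"
          using eventually_ge_at_top[of N]
        proof eventually_elim
          case (elim n)
          have "x \<in> box (- (real n *\<^sub>R One)) (real n *\<^sub>R One)"
            using N elim by (force simp: box_def)
          then show ?case by simp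
        qed
        then show "(\<lambda>n. indicator (box (- (real n *\<^sub>R One)) (real n *\<^sub>R One)) x * f x) \<longlonglongrightarrow> f x"
          by (rule tendsto_eventually)
      qed
    qed (use f in \<open>auto simp: abs_mult indicator_def\<close>)
    then have "(\<integral>x. f x \<partial>lborel) = 0"
      by (simp add: boxes LIMSEQ_const_iff)
    then have "(\<integral>x. f x - indicator A x * f x \<partial>lborel) = 0"
      using f ind[OF Ab] IH by simp
    moreover have "(\<lambda>x. f x - indicator A x * f x) = (\<lambda>x. indicator (UNIV - A) x * f x)"
      by (auto split: split_indicator)
    ultimately show "(\<integral>x. indicator (UNIV - A) x * f x \<partial>lborel) = 0" by simp
  next
    fix A :: "nat \<Rightarrow> 'a set"
    assume disj: "disjoint_family A" and A: "range A \<subseteq> sigma_sets UNIV ?E"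
      and IH: "\<And>i. (\<integral>x. indicator (A i) x * f x \<partial>lborel) = 0"
    have Ab: "A i \<in> sets lborel" for i using A by (auto simp: borel_eq_box sets_measure_of)
    have "(\<integral>x\<in>(\<Union>i. A i). f x \<partial>lborel) = (\<Sum>i. (\<integral>x\<in>A i. f x \<partial>lborel))"
    proof (rule lebesgue_integral_countable_add[OF Ab])
      show "A i \<inter> A j = {}" if "i \<noteq> j" for i j
        using disj that by (auto simp: disjoint_family_on_def)
      have "(\<Union>i. A i) \<in> sets borel" using Ab by auto
      then show "set_integrable lborel (\<Union>i. A i) f"
        using ind by (simp add: set_integrable_def)
    qed
    then show "(\<integral>x. indicator (\<Union>i. A i) x * f x \<partial>lborel) = 0"
      using IH by (simp add: set_lebesgue_integral_def)
  qed
  show ?thesis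
  proof (rule density_unique_real[where f' = "\<lambda>_. 0"])
    fix A :: "'a set" assume "A \<in> sets lborel"
    then show "(\<integral>x\<in>A. f x \<partial>lborel) = (\<integral>x\<in>A. 0 \<partial>lborel)"
      using zero[of A] by (simp add: set_lebesgue_integral_def borel_eq_box sets_measure_of)
  qed (use f in auto)
qed

text \<open>Local version: cutting \<open>f\<close> off to a large box keeps the hypothesis, because
  the intersection of two boxes is a box.\<close>
lemma AE_zero_if_complex_integral_boxes_zero:
  fixes f :: "'a::euclidean_space \<Rightarrow> complex"
  assumes m: "f \<in> borel_measurable lebesgue"
    and int: "\<And>a b. integrable lebesgue (\<lambda>x. indicator (box a b) x * f x)"
    and boxes: "\<And>a b. (\<integral>x. indicator (box a b) x * f x \<partial>lebesgue) = 0"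
  shows "AE x in lebesgue. f x = 0"
proof -
  have real_case: "AE x in lebesgue. g x = 0"
    if gm[measurable]: "g \<in> borel_measurable lebesgue"
      and gint: "\<And>a b. integrable lebesgue (\<lambda>x. indicator (box a b) x * g x)"
      and gz: "\<And>a b. (\<integral>x. indicator (box a b) x * g x \<partial>lebesgue) = 0"
    for g :: "'a \<Rightarrow> real"
  proof -
    obtain h where h[measurable]: "h \<in> borel_measurable lborel" and gh: "AE x in lborel. g x = h x"
      using completion_ex_borel_measurable_real[OF gm] by auto
    have ghc: "AE x in lebesgue. g x = h x" using gh by (rule AE_completion)
    have eq: "integrable lborel (\<lambda>x. indicator (box a b) x * h x) \<and>
       (\<integral>x. indicator (box a b) x * h x \<partial>lborel) = 0" for a b
    proof -
      have hm[measurable]: "h \<in> borel_measurable lebesgue" using h by (rule measurable_completion)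
      have ae: "AE x in lebesgue. indicator (box a b) x * g x = indicator (box a b) x * h x"
        using ghc by eventually_elim simp
      have "integrable lebesgue (\<lambda>x. indicator (box a b) x * h x)"
        using gint[of a b] ae gm hm
        by (subst integrable_cong_AE[symmetric, OF _ _ ae])
           (auto intro!: borel_measurable_times borel_measurable_indicator)
      moreover have "(\<integral>x. indicator (box a b) x * h x \<partial>lebesgue) = 0"
        using gz[of a b] ae gm hm
        by (subst integral_cong_AE[symmetric, OF _ _ ae])
           (auto intro!: borel_measurable_times borel_measurable_indicator)
      ultimately show ?thesis
        by (simp add: integrable_completion integral_completion)
    qed
    have "AE x in lborel. indicator (box (- (real n *\<^sub>R One)) (real n *\<^sub>R One)) x * h x = 0" for n
    proof (rule AE_zero_if_integral_boxes_zero)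
      fix a b :: 'a
      obtain c d where "box a b \<inter> box (- (real n *\<^sub>R One)) (real n *\<^sub>R One) = box c d"
        using box_Int_box by blast
      then show "(\<integral>x. indicator (box a b) x * (indicator (box (- (real n *\<^sub>R One)) (real n *\<^sub>R One)) x * h x) \<partial>lborel) = 0"
        using eq[of c d] by (simp add: mult.assoc[symmetric] indicator_inter_arith[symmetric])
    qed (use eq in auto)
    then have "AE x in lborel. \<forall>n. indicator (box (- (real n *\<^sub>R One)) (real n *\<^sub>R One)) x * h x = 0"
      by (intro AE_all_countable[THEN iffD2] allI)
    then have "AE x in lborel. g x = 0"
      using gh
    proof eventually_elim
      case (elim x)
      obtain N where "x \<in> box (- (real N *\<^sub>R One)) (real N *\<^sub>R One)"
        using UN_box_eq_UNIV by blast
      then show ?case using elim by (auto simp: indicator_def)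
    qed
    then show ?thesis by (rule AE_completion)
  qed
  have [measurable]: "f \<in> borel_measurable lebesgue" by fact
  have Re: "Re (indicator A x) = indicator A x" and Im: "Im (indicator A x) = 0"
    for A and x :: 'a by (auto split: split_indicator)
  have "AE x in lebesgue. Re (f x) = 0"
    by (rule real_case)
       (use integrable_Re[OF int] integral_Re[OF int] boxes in \<open>auto simp: Re Im\<close>)
  moreover have "AE x in lebesgue. Im (f x) = 0"
    by (rule real_case)
       (use integrable_Im[OF int] integral_Im[OF int] boxes in \<open>auto simp: Re Im\<close>)
  ultimately show ?thesis
    by eventually_elim (simp add: complex_eq_iff)
qed

section \<open>Translation invariance of Lebesgue measure\<close>

lemma distr_lebesgue_translation:
  fixes a :: "'a::euclidean_space"
  shows measurable_lebesgue_translation: "(\<lambda>x. x + a) \<in> lebesgue \<rightarrow>\<^sub>M lebesgue"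
    and "distr lebesgue lebesgue (\<lambda>x. x + a) = lebesgue"
proof -
  have eq: "(\<lambda>x. a + (\<Sum>j\<in>Basis. (1 * (x \<bullet> j)) *\<^sub>R j)) = (\<lambda>x. x + a)"
    by (simp add: euclidean_representation add.commute)
  show "(\<lambda>x. x + a) \<in> lebesgue \<rightarrow>\<^sub>M lebesgue"
    using lebesgue_affine_measurable[of "\<lambda>_. 1" a] unfolding eq by simp
  have "lebesgue = density (distr lebesgue lebesgue (\<lambda>x. x + a)) (\<lambda>_. 1)"
    using lebesgue_affine_euclidean[of "\<lambda>_. 1" a] unfolding eq by simp
  then show "distr lebesgue lebesgue (\<lambda>x. x + a) = lebesgue"
    by (simp add: density_1)
qed

lemma measurable_translate:
  fixes a :: "'a::euclidean_space"
  assumes "f \<in> lebesgue \<rightarrow>\<^sub>M N"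
  shows "(\<lambda>x. f (x + a)) \<in> lebesgue \<rightarrow>\<^sub>M N"
  using measurable_compose[OF measurable_lebesgue_translation assms] .

lemma nn_integral_lebesgue_translate:
  fixes a :: "'a::euclidean_space"
  assumes f: "f \<in> borel_measurable lebesgue"
  shows "(\<integral>\<^sup>+x. f (x + a) \<partial>lebesgue) = (\<integral>\<^sup>+x. f x \<partial>lebesgue)"
  using nn_integral_distr[OF measurable_lebesgue_translation, of f a] f
  by (simp add: distr_lebesgue_translation)

lemma integrable_lebesgue_translate:
  fixes a :: "'a::euclidean_space" and f :: "'a \<Rightarrow> 'b::{banach, second_countable_topology}"
  assumes f: "integrable lebesgue f"
  shows "integrable lebesgue (\<lambda>x. f (x + a))"
  using integrable_distr_eq[OF measurable_lebesgue_translation, of f a] f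
  by (simp add: distr_lebesgue_translation)

lemma integral_lebesgue_translate:
  fixes a :: "'a::euclidean_space" and f :: "'a \<Rightarrow> 'b::{banach, second_countable_topology}"
  assumes f: "f \<in> borel_measurable lebesgue"
  shows "(\<integral>x. f (x + a) \<partial>lebesgue) = (\<integral>x. f x \<partial>lebesgue)"
  using integral_distr[OF measurable_lebesgue_translation, of f a] f
  by (simp add: distr_lebesgue_translation)

section \<open>Uniqueness and translation of Fourier transforms\<close>

lemma integrable_mult_sq_integrable:
  fixes f h :: "real^'d \<Rightarrow> complex"
  assumes "sq_integrable f" "sq_integrable h"
  shows "integrable lebesgue (\<lambda>x. f x * h x)"
proof (rule Bochner_Integration.integrable_bound)
  show "integrable lebesgue (\<lambda>x. (norm (f x))\<^sup>2 + (norm (h x))\<^sup>2)"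
    using assms by (auto simp: sq_integrable_def)
  have [measurable]: "f \<in> borel_measurable lebesgue" "h \<in> borel_measurable lebesgue"
    using assms by (auto simp: sq_integrable_def)
  show "(\<lambda>x. f x * h x) \<in> borel_measurable lebesgue" by measurable
  have "norm (f x) * norm (h x) \<le> (norm (f x))\<^sup>2 + (norm (h x))\<^sup>2" for x
  proof -
    have "0 \<le> norm (f x) * norm (h x)" by simp
    then show ?thesis
      using sum_squares_bound[of "norm (f x)" "norm (h x)"] by linarith
  qed
  then show "AE x in lebesgue. norm (f x * h x) \<le> norm ((norm (f x))\<^sup>2 + (norm (h x))\<^sup>2)"
    by (simp add: norm_mult)
qed

text \<open>Pairing with a square integrable function is continuous in \<open>L\<^sup>2\<close>, by the Cauchy-Schwarz
  inequality. Integrability of the products is assumed separately because the approximants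
  need not be square integrable individually: this is the situation for \<open>fourier_integral (g i)\<close>.\<close>
lemma L2_tendsto_integral_mult:
  fixes u :: "nat \<Rightarrow> real^'d \<Rightarrow> complex"
  assumes lim: "L2_tendsto u f"
    and [measurable]: "\<And>i. u i \<in> borel_measurable lebesgue" "f \<in> borel_measurable lebesgue"
    and h: "sq_integrable h"
    and ui: "\<And>i. integrable lebesgue (\<lambda>x. u i x * h x)"
    and fi: "integrable lebesgue (\<lambda>x. f x * h x)"
  shows "(\<lambda>i. \<integral>x. u i x * h x \<partial>lebesgue) \<longlonglongrightarrow> (\<integral>x. f x * h x \<partial>lebesgue)"
proof -
  have [measurable]: "h \<in> borel_measurable lebesgue" and h2: "integrable lebesgue (\<lambda>x. (norm (h x))\<^sup>2)"
    using h by (auto simp: sq_integrable_def)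
  define H where "H = (\<integral>\<^sup>+x. ennreal ((norm (h x))\<^sup>2) \<partial>lebesgue)"
  have H: "H < top"
    using h2 by (simp add: integrable_iff_bounded H_def)
  define E where "E i = (\<integral>\<^sup>+x. ennreal ((norm (u i x - f x))\<^sup>2) \<partial>lebesgue)" for i
  have E: "E \<longlonglongrightarrow> 0"
    using lim by (simp add: L2_tendsto_def E_def[abs_def])
  define d where "d i = norm ((\<integral>x. u i x * h x \<partial>lebesgue) - (\<integral>x. f x * h x \<partial>lebesgue))" for i
  have bound: "ennreal ((d i)\<^sup>2) \<le> E i * H" for i
  proof -
    have int: "integrable lebesgue (\<lambda>x. (u i x - f x) * h x)"
      using ui[of i] fi by (simp add: left_diff_distrib)
    have "d i = norm (\<integral>x. (u i x - f x) * h x \<partial>lebesgue)"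
      using ui[of i] fi by (simp add: d_def left_diff_distrib)
    then have "ennreal (d i) \<le> (\<integral>\<^sup>+x. ennreal (norm ((u i x - f x) * h x)) \<partial>lebesgue)"
      using integral_norm_bound_ennreal[OF int] by simp
    also have "\<dots> = (\<integral>\<^sup>+x. ennreal (norm (u i x - f x)) * ennreal (norm (h x)) \<partial>lebesgue)"
      by (simp add: norm_mult ennreal_mult)
    finally have "(ennreal (d i))\<^sup>2 \<le> (\<integral>\<^sup>+x. ennreal (norm (u i x - f x)) * ennreal (norm (h x)) \<partial>lebesgue)\<^sup>2"
      by (rule power_mono) simp
    also have "\<dots> \<le> E i * H"
      unfolding E_def H_def
      using Cauchy_Schwarz_nn_integral[of "\<lambda>x. ennreal (norm (u i x - f x))" lebesgue "\<lambda>x. ennreal (norm (h x))"]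
      by (simp add: ennreal_power)
    finally show ?thesis
      by (simp add: ennreal_power d_def)
  qed
  have "(\<lambda>i. E i * H) \<longlonglongrightarrow> 0"
    using ennreal_tendsto_cmult[OF H E] by (simp add: mult.commute)
  then have "(\<lambda>i. ennreal ((d i)\<^sup>2)) \<longlonglongrightarrow> ennreal 0"
    unfolding ennreal_0
    by (rule tendsto_sandwich[OF always_eventually always_eventually tendsto_const, rotated 2])
       (use bound in simp_all)
  then have "(\<lambda>i. (d i)\<^sup>2) \<longlonglongrightarrow> 0"
    by (rule tendsto_ennrealD) auto
  then have "(\<lambda>i. sqrt ((d i)\<^sup>2)) \<longlonglongrightarrow> sqrt 0"
    by (rule tendsto_real_sqrt)
  then have "d \<longlonglongrightarrow> 0" by (simp add: d_def[abs_def])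
  then show ?thesis
    unfolding d_def tendsto_norm_zero_iff by (rule LIM_zero_cancel)
qed

lemma sq_integrable_indicator_box:
  "sq_integrable (indicator (box a b) :: real^'d \<Rightarrow> complex)"
  and integrable_indicator_box: "integrable lebesgue (indicator (box a b) :: real^'d \<Rightarrow> complex)"
proof -
  have m: "(indicator (box a b) :: real^'d \<Rightarrow> complex) \<in> borel_measurable lebesgue"
    by (rule borel_measurable_indicator) simp
  have r: "integrable lebesgue (indicator (box a b) :: real^'d \<Rightarrow> real)"
    by (rule integrable_real_indicator) (auto simp: emeasure_lborel_box_finite[unfolded infinity_ennreal_def])
  then show "integrable lebesgue (indicator (box a b) :: real^'d \<Rightarrow> complex)"
    by (rule Bochner_Integration.integrable_bound) (auto simp: m indicator_def)
  have "(\<lambda>x. (norm (indicator (box a b) x :: complex))\<^sup>2) = (indicator (box a b) :: real^'d \<Rightarrow> real)"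
    by (auto simp: indicator_def)
  then show "sq_integrable (indicator (box a b) :: real^'d \<Rightarrow> complex)"
    using m r by (simp add: sq_integrable_def)
qed

text \<open>Along a sequence that defines \<open>F\<close>, both sides of \<open>integral_fourier_mult_swap\<close> with the box as
  test function converge, to the two sides below. Since \<open>F\<close> does not occur on the right,
  the integrals of a transform over boxes are determined by \<open>f\<close>.\<close>
lemma has_fourier_integral_box:
  fixes f :: "real^'d \<Rightarrow> complex"
  assumes "has_fourier f F"
  shows "(\<integral>\<omega>. F \<omega> * indicator (box a b) \<omega> \<partial>lebesgue)
       = (\<integral>x. f x * fourier_integral (indicator (box a b)) x \<partial>lebesgue)"
proof -
  let ?h = "indicator (box a b) :: real^'d \<Rightarrow> complex"
  from assms obtain g where f: "sq_integrable f" and F: "sq_integrable F"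
    and gi: "\<And>i. integrable lebesgue (g i)" and gs: "\<And>i. sq_integrable (g i)"
    and gf: "L2_tendsto g f" and gF: "L2_tendsto (\<lambda>i. fourier_integral (g i)) F"
    unfolding has_fourier_def by blast
  have gm[measurable]: "\<And>i. g i \<in> borel_measurable lebesgue" using gi by auto
  have [measurable]: "f \<in> borel_measurable lebesgue" "F \<in> borel_measurable lebesgue"
    using f F by (auto simp: sq_integrable_def)
  have lim: "(\<lambda>i. \<integral>\<omega>. fourier_integral (g i) \<omega> * ?h \<omega> \<partial>lebesgue) \<longlonglongrightarrow> (\<integral>\<omega>. F \<omega> * ?h \<omega> \<partial>lebesgue)"
  proof (rule L2_tendsto_integral_mult[OF gF])
    fix i
    show m[measurable]: "fourier_integral (g i) \<in> borel_measurable lebesgue"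
      by (rule fourier_integral_measurable) simp
    have "integrable lebesgue (\<lambda>\<omega>. of_real (LINT x|lebesgue. norm (g i x)) * ?h \<omega>)"
      by (rule integrable_mult_right) (rule integrable_indicator_box)
    then show "integrable lebesgue (\<lambda>\<omega>. fourier_integral (g i) \<omega> * ?h \<omega>)"
    proof (rule Bochner_Integration.integrable_bound)
      show "(\<lambda>\<omega>. fourier_integral (g i) \<omega> * ?h \<omega>) \<in> borel_measurable lebesgue"
        by (intro borel_measurable_times m borel_measurable_indicator) simp
      have "norm (fourier_integral (g i) \<omega> * ?h \<omega>) \<le> norm (of_real (LINT x|lebesgue. norm (g i x)) * ?h \<omega>)" for \<omega>
      proof -
        have "norm (fourier_integral (g i) \<omega>) \<le> norm (of_real (LINT x|lebesgue. norm (g i x)) :: complex)"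
          by (rule order_trans[OF norm_fourier_integral_le]) (simp only: norm_of_real abs_ge_self)
        then show ?thesis
          unfolding norm_mult by (rule mult_right_mono) (rule norm_ge_zero)
      qed
      then show "AE \<omega> in lebesgue. norm (fourier_integral (g i) \<omega> * ?h \<omega>)
          \<le> norm (of_real (LINT x|lebesgue. norm (g i x)) * ?h \<omega>)"
        by (rule AE_I2)
    qed
  next
    show "F \<in> borel_measurable lebesgue" by fact
    show "sq_integrable ?h" by (rule sq_integrable_indicator_box)
    show "integrable lebesgue (\<lambda>\<omega>. F \<omega> * ?h \<omega>)"
      by (rule integrable_mult_sq_integrable[OF F sq_integrable_indicator_box])
  qed
  have swap: "(\<integral>\<omega>. fourier_integral (g i) \<omega> * ?h \<omega> \<partial>lebesgue)
      = (\<integral>x. g i x * fourier_integral ?h x \<partial>lebesgue)" for i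
    by (rule integral_fourier_mult_swap[OF gi integrable_indicator_box])
  have lim': "(\<lambda>i. \<integral>x. g i x * fourier_integral ?h x \<partial>lebesgue)
      \<longlonglongrightarrow> (\<integral>x. f x * fourier_integral ?h x \<partial>lebesgue)"
    by (intro L2_tendsto_integral_mult[OF gf] gm integrable_mult_sq_integrable
          sq_integrable_fourier_integral_box f gs) fact
  show ?thesis
    by (rule LIMSEQ_unique[OF lim lim'[folded swap]])
qed

theorem has_fourier_unique:
  fixes f :: "real^'d \<Rightarrow> complex"
  assumes F: "has_fourier f F" and G: "has_fourier f G"
  shows "AE \<omega> in lebesgue. F \<omega> = G \<omega>"
proof -
  have FG: "sq_integrable F" "sq_integrable G" using F G by (auto simp: has_fourier_def)
  then have [measurable]: "F \<in> borel_measurable lebesgue" "G \<in> borel_measurable lebesgue"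
    by (auto simp: sq_integrable_def)
  have int: "integrable lebesgue (\<lambda>\<omega>. H \<omega> * indicator (box a b) \<omega>)" if "sq_integrable H"
    for H :: "real^'d \<Rightarrow> complex" and a b
    by (rule integrable_mult_sq_integrable[OF that sq_integrable_indicator_box])
  have eq: "indicator (box a b) \<omega> * (F \<omega> - G \<omega>) = F \<omega> * indicator (box a b) \<omega> - G \<omega> * indicator (box a b) \<omega>"
    for a b \<omega> by (simp add: algebra_simps)
  have "AE \<omega> in lebesgue. F \<omega> - G \<omega> = 0"
  proof (rule AE_zero_if_complex_integral_boxes_zero)
    fix a b :: "real^'d"
    show "integrable lebesgue (\<lambda>\<omega>. indicator (box a b) \<omega> * (F \<omega> - G \<omega>))"
      unfolding eq using int FG by simp
    show "(\<integral>\<omega>. indicator (box a b) \<omega> * (F \<omega> - G \<omega>) \<partial>lebesgue) = 0"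
      unfolding eq using int FG has_fourier_integral_box[OF F, of a b] has_fourier_integral_box[OF G, of a b]
      by simp
  qed simp
  then show ?thesis by simp
qed

text \<open>The value chosen by \<open>fourier\<close> can be replaced by any known transform under an integral.\<close>
lemma AE_fourier_eq: "has_fourier f F \<Longrightarrow> AE \<omega> in lebesgue. fourier f \<omega> = F \<omega>"
  and has_fourier_fourier: "has_fourier f F \<Longrightarrow> has_fourier f (fourier f)"
proof -
  show "has_fourier f (fourier f)" if "has_fourier f F"
    unfolding fourier_def using that by (rule someI[of "has_fourier f"])
  then show "AE \<omega> in lebesgue. fourier f \<omega> = F \<omega>" if "has_fourier f F"
    using that has_fourier_unique by blast
qed

lemma fourier_integral_translate:
  fixes f :: "real^'d \<Rightarrow> complex"
  assumes [measurable]: "f \<in> borel_measurable lebesgue"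
  shows "fourier_integral (\<lambda>x. f (x - a)) \<omega> = wave a \<omega> * fourier_integral f \<omega>"
proof -
  have m: "(\<lambda>x. f (x + (- a)) * wave \<omega> x) \<in> borel_measurable lebesgue"
    by (intro borel_measurable_times measurable_translate) auto
  have "fourier_integral (\<lambda>x. f (x - a)) \<omega> = (LINT x|lebesgue. f x * wave \<omega> (x + a))"
    unfolding fourier_integral_wave
    using integral_lebesgue_translate[OF m, of a] by simp
  also have "\<dots> = (LINT x|lebesgue. wave \<omega> a * (f x * wave \<omega> x))"
    by (simp add: wave_add mult_ac)
  also have "\<dots> = wave \<omega> a * fourier_integral f \<omega>"
    by (simp add: fourier_integral_wave)
  also have "wave \<omega> a = wave a \<omega>"
    by (simp add: wave_def inner_commute)
  finally show ?thesis .
qed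

lemma L2_tendsto_translate:
  assumes "L2_tendsto g f" and [measurable]: "\<And>i. g i \<in> borel_measurable lebesgue" "f \<in> borel_measurable lebesgue"
  shows "L2_tendsto (\<lambda>i x. g i (x - a)) (\<lambda>x. f (x - a))"
proof -
  have "(\<integral>\<^sup>+x. ennreal ((norm (g i (x - a) - f (x - a)))\<^sup>2) \<partial>lebesgue)
     = (\<integral>\<^sup>+x. ennreal ((norm (g i x - f x))\<^sup>2) \<partial>lebesgue)" for i
    using nn_integral_lebesgue_translate[of "\<lambda>x. ennreal ((norm (g i x - f x))\<^sup>2)" "- a"] by simp
  then show ?thesis using assms(1) by (simp add: L2_tendsto_def)
qed

lemma sq_integrable_translate:
  assumes "sq_integrable f"
  shows "sq_integrable (\<lambda>x. f (x - a))"
  using assms measurable_translate[of f borel "- a"]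
    integrable_lebesgue_translate[of "\<lambda>x. (norm (f x))\<^sup>2" "- a"]
  by (simp add: sq_integrable_def)

theorem has_fourier_translate:
  fixes f :: "real^'d \<Rightarrow> complex"
  assumes "has_fourier f F"
  shows "has_fourier (\<lambda>x. f (x - a)) (\<lambda>\<omega>. wave a \<omega> * F \<omega>)"
proof -
  from assms obtain g where f: "sq_integrable f" and F: "sq_integrable F"
    and gi: "\<And>i. integrable lebesgue (g i)" and gs: "\<And>i. sq_integrable (g i)"
    and gf: "L2_tendsto g f" and gF: "L2_tendsto (\<lambda>i. fourier_integral (g i)) F"
    unfolding has_fourier_def by blast
  have gm[measurable]: "\<And>i. g i \<in> borel_measurable lebesgue" using gi by auto
  have [measurable]: "f \<in> borel_measurable lebesgue" "F \<in> borel_measurable lebesgue"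
    using f F by (auto simp: sq_integrable_def)
  show ?thesis
    unfolding has_fourier_def
  proof (intro conjI exI[of _ "\<lambda>i x. g i (x - a)"] allI)
    show "sq_integrable (\<lambda>\<omega>. wave a \<omega> * F \<omega>)"
      using F by (auto simp: sq_integrable_def norm_mult)
    show "integrable lebesgue (\<lambda>x. g i (x - a))" for i
      using integrable_lebesgue_translate[OF gi, of i "- a"] by simp
    show "L2_tendsto (\<lambda>i x. g i (x - a)) (\<lambda>x. f (x - a))"
      by (rule L2_tendsto_translate[OF gf]) auto
    have "wave a \<omega> * z - wave a \<omega> * w = wave a \<omega> * (z - w)" for \<omega> z w
      by (simp add: algebra_simps)
    then show "L2_tendsto (\<lambda>i. fourier_integral (\<lambda>x. g i (x - a))) (\<lambda>\<omega>. wave a \<omega> * F \<omega>)"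
      using gF by (simp add: L2_tendsto_def fourier_integral_translate norm_mult)
  qed (auto intro: sq_integrable_translate f gs)
qed

section \<open>Sums and powers of nonnegative families\<close>

lemma integral_count_space_eq_infsum:
  fixes s :: "'i \<Rightarrow> real"
  assumes "s summable_on A" and "\<And>i. i \<in> A \<Longrightarrow> 0 \<le> s i"
  shows integrable_count_space_if_summable: "integrable (count_space A) s"
    and "integral\<^sup>L (count_space A) s = infsum s A"
    and nn_integral_count_space_eq_infsum: "(\<integral>\<^sup>+i. ennreal (s i) \<partial>count_space A) = ennreal (infsum s A)"
proof -
  have "(\<lambda>i. norm (s i)) summable_on A"
    using assms by (subst summable_on_cong[where g = s]) auto
  note abs = this[unfolded abs_summable_equivalent]
  then show int: "integrable (count_space A) s" by (simp add: abs_summable_on_def)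
  show eq: "integral\<^sup>L (count_space A) s = infsum s A"
    using infsetsum_infsum[OF abs] by (simp add: infsetsum_def)
  show "(\<integral>\<^sup>+i. ennreal (s i) \<partial>count_space A) = ennreal (infsum s A)"
    using nn_integral_eq_integral[OF int] assms(2) eq by (simp add: AE_count_space)
qed

lemma summable_on_power:
  fixes s :: "'i \<Rightarrow> real"
  assumes s: "s summable_on A" and nonneg: "\<And>i. i \<in> A \<Longrightarrow> 0 \<le> s i"
  shows "(\<lambda>i. s i ^ Suc n) summable_on A"
proof (rule summable_on_comparison_test)
  show "(\<lambda>i. infsum s A ^ n * s i) summable_on A"
    using s by (rule summable_on_cmult_right)
  fix i assume i: "i \<in> A"
  have "s i = infsum s {i}" by simp
  also have "\<dots> \<le> infsum s A"
    using s nonneg i by (intro infsum_mono_neutral) auto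
  finally have "s i ^ n \<le> infsum s A ^ n"
    using nonneg[OF i] by (rule power_mono)
  then show "s i ^ Suc n \<le> infsum s A ^ n * s i"
    using nonneg[OF i] by (simp add: mult.commute mult_left_mono)
  show "0 \<le> s i ^ Suc n" using nonneg[OF i] by simp
qed

text \<open>Divide by the largest term: the reciprocal of the quotient is the sum of the powers of
  \<open>s i / s i0\<close>. Each of them tends to zero except the one for \<open>i0\<close>, and all of them are
  dominated by the summable family \<open>s i / s i0\<close>.\<close>
lemma normalized_power_tendsto_1:
  fixes s :: "'i \<Rightarrow> real"
  assumes s: "s summable_on UNIV" and nonneg: "\<And>i. 0 \<le> s i"
    and max: "\<And>i. i \<noteq> i0 \<Longrightarrow> s i < s i0"
    and pos: "0 < s i0"
  shows "(\<lambda>n. s i0 ^ Suc n / (\<Sum>\<^sub>\<infinity>i. s i ^ Suc n)) \<longlonglongrightarrow> 1"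
proof -
  define t where "t i = s i / s i0" for i
  have t: "t summable_on UNIV" "0 \<le> t i" for i
    using summable_on_cmult_left[OF s, of "inverse (s i0)"] nonneg pos
    by (auto simp: t_def[abs_def] divide_inverse)
  have t0: "t i0 = 1" and t1: "i \<noteq> i0 \<Longrightarrow> t i < 1" for i
    using pos max by (auto simp: t_def)
  then have t_le: "t i \<le> 1" for i by (cases "i = i0") (auto intro: less_imp_le)
  have "(\<lambda>n. \<integral>i. t i ^ Suc n \<partial>count_space UNIV) \<longlonglongrightarrow> (\<integral>i. indicator {i0} i \<partial>count_space UNIV)"
  proof (rule integral_dominated_convergence[where w = t])
    show "integrable (count_space UNIV) t"
      using t by (intro integrable_count_space_if_summable)
    show "AE i in count_space UNIV. (\<lambda>n. t i ^ Suc n) \<longlonglongrightarrow> indicator {i0} i"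
    proof (rule AE_I2)
      fix i
      show "(\<lambda>n. t i ^ Suc n) \<longlonglongrightarrow> indicator {i0} i"
      proof (cases "i = i0")
        case False
        then have "(\<lambda>n. t i ^ n) \<longlonglongrightarrow> 0"
          using t t1 by (intro LIMSEQ_realpow_zero) auto
        then show ?thesis using False by (simp add: LIMSEQ_Suc del: power_Suc)
      qed (simp add: t0)
    qed
    fix n
    have "t i * t i ^ n \<le> t i * 1" for i
      using t t_le by (intro mult_left_mono power_le_one) auto
    then show "AE i in count_space UNIV. norm (t i ^ Suc n) \<le> t i"
      using t by (simp add: abs_mult)
  qed auto
  moreover have "(\<integral>i. t i ^ Suc n \<partial>count_space UNIV) = inverse (s i0 ^ Suc n / (\<Sum>\<^sub>\<infinity>i. s i ^ Suc n))" for n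
  proof -
    have "(\<integral>i. t i ^ Suc n \<partial>count_space UNIV) = (\<Sum>\<^sub>\<infinity>i. t i ^ Suc n)"
      using t by (intro integral_count_space_eq_infsum summable_on_power) auto
    also have "\<dots> = (\<Sum>\<^sub>\<infinity>i. s i ^ Suc n * inverse (s i0 ^ Suc n))"
      by (simp only: t_def power_divide) (simp only: divide_inverse)
    also have "\<dots> = (\<Sum>\<^sub>\<infinity>i. s i ^ Suc n) * inverse (s i0 ^ Suc n)"
      by (rule infsum_cmult_left')
    finally show ?thesis by (simp add: field_simps)
  qed
  ultimately have "(\<lambda>n. inverse (s i0 ^ Suc n / (\<Sum>\<^sub>\<infinity>i. s i ^ Suc n))) \<longlonglongrightarrow> 1"
    by (simp del: power_Suc)
  from tendsto_inverse[OF this] show ?thesis by simp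
qed

section \<open>Partitions of unity along a lattice\<close>

lemma borel_measurable_nn_integral_count_space:
  fixes f :: "'i::countable \<Rightarrow> 'a \<Rightarrow> ennreal"
  assumes "\<And>i. f i \<in> borel_measurable M"
  shows "(\<lambda>x. \<integral>\<^sup>+i. f i x \<partial>count_space UNIV) \<in> borel_measurable M"
proof -
  have "(\<lambda>(i, x). f i x) \<in> borel_measurable (count_space UNIV \<Otimes>\<^sub>M M)"
    using assms by (intro measurable_pair_measure_countable1) auto
  from measurable_compose[OF measurable_pair_swap' this]
  have "(\<lambda>(x, i). f i x) \<in> borel_measurable (M \<Otimes>\<^sub>M count_space UNIV)"
    by (simp add: split_beta)
  then show ?thesis
    using sigma_finite_measure.borel_measurable_nn_integral
      [OF sigma_finite_measure_count_space_countable, of "UNIV :: 'i set" "\<lambda>x i. f i x" M]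
    by simp
qed

text \<open>Summing over the lattice can be moved from one factor to the other: exchange sum and
  integral, translate by \<open>- \<Lambda> k\<close>, and reindex by \<open>k \<mapsto> - k\<close>. Taking \<open>g\<close> to be the indicator of a
  fundamental domain folds an integral over the whole space into that domain.\<close>
lemma nn_integral_unfold_lattice:
  fixes \<Lambda> :: "'i::{countable, ab_group_add} \<Rightarrow> 'a::euclidean_space"
    and f g :: "'a \<Rightarrow> ennreal"
  assumes f: "f \<in> borel_measurable lebesgue" and g: "g \<in> borel_measurable lebesgue"
    and add: "\<And>k l. \<Lambda> (k + l) = \<Lambda> k + \<Lambda> l"
  shows "(\<integral>\<^sup>+x. f x * (\<integral>\<^sup>+k. g (x + \<Lambda> k) \<partial>count_space UNIV) \<partial>lebesgue)
       = (\<integral>\<^sup>+x. (\<integral>\<^sup>+k. f (x + \<Lambda> k) \<partial>count_space UNIV) * g x \<partial>lebesgue)"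
proof -
  have zero: "\<Lambda> 0 = 0" using add[of 0 0] by simp
  have minus: "\<Lambda> (- k) = - \<Lambda> k" for k
    using add[of k "- k"] zero by (simp add: eq_neg_iff_add_eq_0 add.commute)
  have [measurable]: "f \<in> borel_measurable lebesgue" "g \<in> borel_measurable lebesgue" by fact+
  note tr = measurable_translate[OF f] measurable_translate[OF g]
  have "(\<integral>\<^sup>+x. f x * (\<integral>\<^sup>+k. g (x + \<Lambda> k) \<partial>count_space UNIV) \<partial>lebesgue)
      = (\<integral>\<^sup>+x. (\<integral>\<^sup>+k. f x * g (x + \<Lambda> k) \<partial>count_space UNIV) \<partial>lebesgue)"
    by (simp add: nn_integral_cmult)
  also have "\<dots> = (\<integral>\<^sup>+k. (\<integral>\<^sup>+x. f x * g (x + \<Lambda> k) \<partial>lebesgue) \<partial>count_space UNIV)"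
    by (rule nn_integral_count_space_nn_integral) (auto intro!: borel_measurable_times_ennreal tr)
  also have "\<dots> = (\<integral>\<^sup>+k. (\<integral>\<^sup>+x. f (x + \<Lambda> (- k)) * g x \<partial>lebesgue) \<partial>count_space UNIV)"
  proof (rule nn_integral_cong)
    fix k
    have "(\<lambda>x. f (x + \<Lambda> (- k)) * g x) \<in> borel_measurable lebesgue"
      by (intro borel_measurable_times_ennreal tr g)
    from nn_integral_lebesgue_translate[OF this, of "\<Lambda> k"]
    show "(\<integral>\<^sup>+x. f x * g (x + \<Lambda> k) \<partial>lebesgue) = (\<integral>\<^sup>+x. f (x + \<Lambda> (- k)) * g x \<partial>lebesgue)"
      by (simp add: minus)
  qed
  also have "\<dots> = (\<integral>\<^sup>+k. (\<integral>\<^sup>+x. f (x + \<Lambda> k) * g x \<partial>lebesgue) \<partial>count_space UNIV)"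
    by (rule nn_integral_bij_count_space[where g = "\<lambda>k. - k"])
       (auto intro!: bij_betwI[where g = "\<lambda>k. - k"])
  also have "\<dots> = (\<integral>\<^sup>+x. (\<integral>\<^sup>+k. f (x + \<Lambda> k) * g x \<partial>count_space UNIV) \<partial>lebesgue)"
    by (rule nn_integral_count_space_nn_integral[symmetric])
       (auto intro!: borel_measurable_times_ennreal tr)
  also have "\<dots> = (\<integral>\<^sup>+x. (\<integral>\<^sup>+k. f (x + \<Lambda> k) \<partial>count_space UNIV) * g x \<partial>lebesgue)"
    by (simp add: nn_integral_multc)
  finally show ?thesis .
qed

text \<open>An abstraction of \<open>m_fun D j \<Phi> n\<close> for \<open>n \<ge> 1\<close>: the integral estimates depend on the translates
  forming a partition of unity, and not on the quotient that defines \<open>m_fun\<close>.\<close>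
locale lattice_partition =
  fixes \<Lambda> :: "'i::{countable, ab_group_add} \<Rightarrow> 'a::euclidean_space"
    and m :: "'a \<Rightarrow> real"
  assumes add: "\<And>k l. \<Lambda> (k + l) = \<Lambda> k + \<Lambda> l"
    and meas [measurable]: "m \<in> borel_measurable lebesgue"
    and nonneg: "\<And>x. 0 \<le> m x"
    and partition: "\<And>x. ((\<lambda>k. m (x + \<Lambda> k)) has_sum 1) UNIV"
begin

lemma nn_integral_translates:
  "(\<integral>\<^sup>+k. ennreal (m (x + \<Lambda> k)) \<partial>count_space UNIV) = 1"
  using partition[of x] nonneg
  by (subst nn_integral_count_space_eq_infsum) (auto simp: has_sum_iff)

lemma zero: "\<Lambda> 0 = 0"
  using add[of 0 0] by simp

lemma le_1: "m x \<le> 1"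
proof -
  have "infsum (\<lambda>k. m (x + \<Lambda> k)) {0} \<le> infsum (\<lambda>k. m (x + \<Lambda> k)) UNIV"
    using partition[of x] nonneg by (intro infsum_mono_neutral) (auto simp: has_sum_iff)
  then show ?thesis
    using partition[of x] by (simp add: has_sum_iff zero)
qed

lemma nn_integral_eq_domain:
  assumes \<Omega>: "\<Omega> \<in> sets lebesgue"
    and tiles: "\<And>x. ((\<lambda>k. indicator \<Omega> (x + \<Lambda> k)) has_sum (1::real)) UNIV"
    and h: "h \<in> borel_measurable lebesgue"
  shows "(\<integral>\<^sup>+x. h x \<partial>lebesgue)
       = (\<integral>\<^sup>+x. (\<integral>\<^sup>+k. h (x + \<Lambda> k) \<partial>count_space UNIV) * indicator \<Omega> x \<partial>lebesgue)"
proof -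
  have one: "(\<integral>\<^sup>+k. indicator \<Omega> (x + \<Lambda> k) \<partial>count_space UNIV) = (1::ennreal)" for x
    using nn_integral_count_space_eq_infsum[of "\<lambda>k. indicator \<Omega> (x + \<Lambda> k)" UNIV] tiles[of x]
    by (simp add: has_sum_iff ennreal_indicator)
  have "(indicator \<Omega> :: 'a \<Rightarrow> ennreal) \<in> borel_measurable lebesgue"
    using \<Omega> by simp
  from nn_integral_unfold_lattice[OF h this add] show ?thesis
    by (simp add: one)
qed

lemma integrable:
  assumes "\<Omega> \<in> sets lebesgue" "emeasure lebesgue \<Omega> < \<infinity>"
    and "\<And>x. ((\<lambda>k. indicator \<Omega> (x + \<Lambda> k)) has_sum (1::real)) UNIV"
  shows "integrable lebesgue m"
proof (rule integrableI_nonneg)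
  have "(\<integral>\<^sup>+x. ennreal (m x) \<partial>lebesgue) = emeasure lebesgue \<Omega>"
    using assms by (subst nn_integral_eq_domain[where \<Omega> = \<Omega>]) (auto simp: nn_integral_translates)
  then show "(\<integral>\<^sup>+x. ennreal (m x) \<partial>lebesgue) < \<infinity>"
    using assms by simp
qed (auto simp: nonneg)

text \<open>Let \<open>b\<close> satisfy \<open>b \<bullet> a = \<pi>\<close>. A periodic nonnegative weight \<open>P\<close> has the same integral
  against any two partitions of unity, in particular against \<open>m\<close> and its translate by \<open>b\<close>.
  For \<open>P = 1 + cos\<close>, the translation changes the sign of the cosine, so the cosine integrates
  to its own negative. The constant 1 only serves to keep the weight nonnegative, and the phase
  \<open>\<theta>\<close> covers the sine as well.\<close>
lemma integral_cos_eq_0: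
  fixes a :: 'a
  assumes int: "integrable lebesgue m" and "a \<noteq> 0"
    and dual: "\<And>k. \<exists>N::int. \<Lambda> k \<bullet> a = 2 * pi * of_int N"
  shows "(\<integral>x. cos (x \<bullet> a + \<theta>) * m x \<partial>lebesgue) = 0"
proof -
  define b where "b = (pi / (a \<bullet> a)) *\<^sub>R a"
  have ab: "b \<bullet> a = pi" using \<open>a \<noteq> 0\<close> by (simp add: b_def)
  define P where "P x = 1 + cos (x \<bullet> a + \<theta>)" for x
  have P_nonneg: "0 \<le> P x" for x
    unfolding P_def using cos_ge_minus_one[of "x \<bullet> a + \<theta>"] by linarith
  have "P \<in> borel_measurable borel"
    unfolding P_def by measurable
  then have [measurable]: "P \<in> borel_measurable lebesgue"
    by (intro measurable_completion) simp
  have P_periodic: "P (x + \<Lambda> k) = P x" for x k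
  proof -
    obtain N :: int where N: "\<Lambda> k \<bullet> a = 2 * pi * of_int N" using dual by blast
    have "cos (x \<bullet> a + \<theta> + 2 * pi * of_int N) = cos (x \<bullet> a + \<theta>)"
      by (simp add: cos_add)
    then show ?thesis by (simp add: P_def inner_add_left N add_ac)
  qed
  have P_shift: "P (x + b) = 2 - P x" for x
    using cos_periodic_pi[of "x \<bullet> a + \<theta>"] by (simp add: P_def inner_add_left ab add_ac)
  have mt: "(\<lambda>x. ennreal (m (x - b))) \<in> borel_measurable lebesgue"
    using measurable_translate[of "\<lambda>x. ennreal (m x)" borel "- b"] by simp
  \<comment> \<open>Insert the partition of unity by translates of \<open>m (x - b)\<close>, then unfold in the other direction.\<close>
  have "(\<integral>\<^sup>+x. ennreal (P x * m x) \<partial>lebesgue)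
      = (\<integral>\<^sup>+x. ennreal (P x * m x) * (\<integral>\<^sup>+k. ennreal (m (x + \<Lambda> k - b)) \<partial>count_space UNIV) \<partial>lebesgue)"
    using nn_integral_translates[of "x - b" for x] by (simp add: algebra_simps)
  also have "\<dots> = (\<integral>\<^sup>+x. (\<integral>\<^sup>+k. ennreal (P (x + \<Lambda> k) * m (x + \<Lambda> k)) \<partial>count_space UNIV) * ennreal (m (x - b)) \<partial>lebesgue)"
    by (rule nn_integral_unfold_lattice[OF _ mt add]) simp
  also have "\<dots> = (\<integral>\<^sup>+x. ennreal (P x * m (x - b)) \<partial>lebesgue)"
    using P_nonneg nonneg
    by (simp add: P_periodic ennreal_mult nn_integral_cmult nn_integral_translates)
  also have "\<dots> = (\<integral>\<^sup>+x. ennreal (P (x + b) * m x) \<partial>lebesgue)"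
  proof -
    have "(\<lambda>x. ennreal (P x * m (x - b))) \<in> borel_measurable lebesgue"
      using mt P_nonneg nonneg by (simp add: ennreal_mult)
    from nn_integral_lebesgue_translate[OF this, of b] show ?thesis by simp
  qed
  finally have eq: "(\<integral>\<^sup>+x. ennreal (P x * m x) \<partial>lebesgue) = (\<integral>\<^sup>+x. ennreal ((2 - P x) * m x) \<partial>lebesgue)"
    by (simp add: P_shift)
  have intc: "integrable lebesgue (\<lambda>x. cos (x \<bullet> a + \<theta>) * m x)"
  proof (rule Bochner_Integration.integrable_bound[OF int])
    have "(\<lambda>x. (P x - 1) * m x) \<in> borel_measurable lebesgue" by measurable
    then show "(\<lambda>x. cos (x \<bullet> a + \<theta>) * m x) \<in> borel_measurable lebesgue"
      by (simp add: P_def)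
    show "AE x in lebesgue. norm (cos (x \<bullet> a + \<theta>) * m x) \<le> norm (m x)"
      using mult_right_mono[OF abs_cos_le_one abs_ge_zero] by (auto simp: abs_mult)
  qed
  have P2: "2 - P x \<ge> 0" for x using P_nonneg[of "x + b"] P_shift[of x] by simp
  have split: "P x * m x = m x + cos (x \<bullet> a + \<theta>) * m x" "(2 - P x) * m x = m x - cos (x \<bullet> a + \<theta>) * m x"
    for x by (simp_all add: P_def algebra_simps)
  have "ennreal (\<integral>x. P x * m x \<partial>lebesgue) = ennreal (\<integral>x. (2 - P x) * m x \<partial>lebesgue)"
    using eq int intc P_nonneg P2 nonneg
    by (subst (asm) nn_integral_eq_integral, (simp add: split)[1], simp)
       (subst (asm) nn_integral_eq_integral, (simp add: split)[1], simp)
  then have "(\<integral>x. P x * m x \<partial>lebesgue) = (\<integral>x. (2 - P x) * m x \<partial>lebesgue)"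
    using P_nonneg P2 nonneg by (subst (asm) ennreal_inj) (auto intro!: integral_nonneg_AE)
  then show ?thesis
    using int intc by (simp add: split)
qed

lemma integral_char_eq_0:
  fixes a :: 'a
  assumes int: "integrable lebesgue m" and a: "a \<noteq> 0"
    and dual: "\<And>k. \<exists>N::int. \<Lambda> k \<bullet> a = 2 * pi * of_int N"
  shows "(\<integral>x. exp (\<i> * of_real (x \<bullet> a)) * of_real (m x) \<partial>lebesgue) = 0"
proof -
  have E [measurable]: "(\<lambda>x. exp (\<i> * of_real (x \<bullet> a))) \<in> borel_measurable lebesgue"
    by (rule measurable_completion)
       (simp add: borel_measurable_continuous_onI continuous_intros)
  have int': "integrable lebesgue (\<lambda>x. exp (\<i> * of_real (x \<bullet> a)) * of_real (m x))"
    using int by (rule Bochner_Integration.integrable_bound) (auto simp: norm_mult)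
  have sin: "sin t = cos (t + - (pi / 2))" for t :: real
    by (simp add: cos_diff)
  have parts: "Re (exp (\<i> * of_real t) * of_real u) = cos t * u"
    "Im (exp (\<i> * of_real t) * of_real u) = cos (t + - (pi / 2)) * u" for t u :: real
    unfolding sin[symmetric] by (simp_all add: Re_exp Im_exp)
  show ?thesis
    using integral_cos_eq_0[OF int a dual, of 0] integral_cos_eq_0[OF int a dual, of "- (pi / 2)"]
      integral_Re[OF int'] integral_Im[OF int']
    unfolding parts by (intro complex_eqI) simp_all
qed

end

lemma tendsto_0_le_ennreal:
  fixes f g :: "nat \<Rightarrow> ennreal"
  assumes "g \<longlonglongrightarrow> 0" and "\<And>n. f n \<le> g n"
  shows "f \<longlonglongrightarrow> 0"
  by (rule tendsto_sandwich[OF always_eventually always_eventually tendsto_const assms(1)])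
     (simp_all add: assms(2))

text \<open>Where one translate of \<open>m n\<close> tends to 1, the partition of unity leaves nothing for the others,
  so the sum of \<open>m n - (m n)\<^sup>2\<close> over the lattice tends to 0. These sums are at most 1 on the
  fundamental domain, which has finite measure, and dominated convergence applies.\<close>
lemma integral_defect_tendsto_0:
  fixes \<Lambda> :: "'i::{countable, ab_group_add} \<Rightarrow> 'a::euclidean_space"
    and m :: "nat \<Rightarrow> 'a \<Rightarrow> real"
  assumes part: "\<And>n. lattice_partition \<Lambda> (m n)"
    and \<Omega>: "\<Omega> \<in> sets lebesgue" "emeasure lebesgue \<Omega> < \<infinity>"
    and tiles: "\<And>x. ((\<lambda>k. indicator \<Omega> (x + \<Lambda> k)) has_sum (1::real)) UNIV"
    and peak: "AE x in lebesgue. x \<in> \<Omega> \<longrightarrow> (\<exists>k. (\<lambda>n. m n (x + \<Lambda> k)) \<longlonglongrightarrow> 1)"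
  shows "(\<lambda>n. \<integral>x. m n x - (m n x)\<^sup>2 \<partial>lebesgue) \<longlonglongrightarrow> 0"
proof -
  have [measurable]: "m n \<in> borel_measurable lebesgue" for n
    by (rule lattice_partition.meas[OF part])
  have nn: "0 \<le> m n x" "m n x \<le> 1" for n x
    using lattice_partition.nonneg[OF part] lattice_partition.le_1[OF part] by auto
  have sq: "(m n x)\<^sup>2 \<le> m n x" for n x
    using nn[of n x] by (simp add: power2_eq_square mult_left_le)
  define d where "d n x = (\<integral>\<^sup>+k. ennreal (m n (x + \<Lambda> k) - (m n (x + \<Lambda> k))\<^sup>2) \<partial>count_space UNIV)" for n x
  \<comment> \<open>The square of a single translate can be added back without exceeding the whole partition.\<close>
  have d_peak: "d n x + ennreal ((m n (x + \<Lambda> k))\<^sup>2) \<le> 1" for n x k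
  proof -
    have "d n x + ennreal ((m n (x + \<Lambda> k))\<^sup>2) = (\<integral>\<^sup>+l. ennreal (m n (x + \<Lambda> l) - (m n (x + \<Lambda> l))\<^sup>2)
        + ennreal ((m n (x + \<Lambda> k))\<^sup>2) * indicator {k} l \<partial>count_space UNIV)"
      unfolding d_def by (subst nn_integral_add) (simp_all add: one_ennreal_def[symmetric])
    also have "\<dots> \<le> (\<integral>\<^sup>+l. ennreal (m n (x + \<Lambda> l)) \<partial>count_space UNIV)"
      using sq by (intro nn_integral_mono)
        (auto simp: ennreal_plus[symmetric] simp del: ennreal_plus intro!: ennreal_leI split: split_indicator)
    also have "\<dots> = 1" by (rule lattice_partition.nn_integral_translates[OF part])
    finally show ?thesis .
  qed
  have d_le: "d n x \<le> 1" for n x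
    by (rule order_trans[OF add_increasing2[OF zero_le order_refl] d_peak])
  have d_meas [measurable]: "d n \<in> borel_measurable lebesgue" for n
  proof -
    have "(\<lambda>x. ennreal (m n x - (m n x)\<^sup>2)) \<in> borel_measurable lebesgue" by measurable
    then show ?thesis
      unfolding d_def[abs_def] by (intro borel_measurable_nn_integral_count_space measurable_translate)
  qed
  have ind: "(indicator \<Omega> :: 'a \<Rightarrow> ennreal) \<in> borel_measurable lebesgue"
    using \<Omega> by simp
  have "(\<lambda>n. \<integral>\<^sup>+x. d n x * indicator \<Omega> x \<partial>lebesgue) \<longlonglongrightarrow> (\<integral>\<^sup>+(x::'a). 0 \<partial>lebesgue)"
  proof (rule nn_integral_dominated_convergence[where w = "indicator \<Omega>"])
    show "(\<lambda>x. d n x * indicator \<Omega> x) \<in> borel_measurable lebesgue" for n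
      by (intro borel_measurable_times_ennreal d_meas ind)
    show "AE x in lebesgue. d n x * indicator \<Omega> x \<le> indicator \<Omega> x" for n
      using d_le by (auto split: split_indicator)
    show "(\<integral>\<^sup>+x. indicator \<Omega> x \<partial>lebesgue) < \<infinity>"
      using \<Omega> by simp
    show "AE x in lebesgue. (\<lambda>n. d n x * indicator \<Omega> x) \<longlonglongrightarrow> 0"
      using peak
    proof eventually_elim
      case (elim x)
      show ?case
      proof (cases "x \<in> \<Omega>")
        case True
        with elim obtain k where k: "(\<lambda>n. m n (x + \<Lambda> k)) \<longlonglongrightarrow> 1" by blast
        have "(\<lambda>n. ennreal (1 - (m n (x + \<Lambda> k))\<^sup>2)) \<longlonglongrightarrow> ennreal (1 - 1\<^sup>2)"
          by (intro tendsto_ennrealI tendsto_intros k)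
        then have "(\<lambda>n. ennreal (1 - (m n (x + \<Lambda> k))\<^sup>2)) \<longlonglongrightarrow> 0" by simp
        moreover have "d n x \<le> ennreal (1 - (m n (x + \<Lambda> k))\<^sup>2)" for n
        proof -
          have "d n x \<le> 1 - ennreal ((m n (x + \<Lambda> k))\<^sup>2)"
            using d_peak[of n x k] by (simp add: ennreal_le_minus_iff add.commute)
          then show ?thesis by (simp add: ennreal_minus[symmetric])
        qed
        ultimately have "(\<lambda>n. d n x) \<longlonglongrightarrow> 0"
          by (rule tendsto_0_le_ennreal)
        then show ?thesis using True by simp
      qed simp
    qed
  qed (use ind in auto)
  moreover have "(\<integral>\<^sup>+x. d n x * indicator \<Omega> x \<partial>lebesgue) = ennreal (\<integral>x. m n x - (m n x)\<^sup>2 \<partial>lebesgue)" for n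
  proof -
    have int: "integrable lebesgue (m n)"
      by (rule lattice_partition.integrable[OF part \<Omega> tiles])
    have "integrable lebesgue (\<lambda>x. m n x - (m n x)\<^sup>2)"
      by (rule Bochner_Integration.integrable_bound[OF int]) (use sq nn in auto)
    then have "ennreal (\<integral>x. m n x - (m n x)\<^sup>2 \<partial>lebesgue) = (\<integral>\<^sup>+x. ennreal (m n x - (m n x)\<^sup>2) \<partial>lebesgue)"
      using sq by (subst nn_integral_eq_integral) auto
    also have "\<dots> = (\<integral>\<^sup>+x. d n x * indicator \<Omega> x \<partial>lebesgue)"
      unfolding d_def by (rule lattice_partition.nn_integral_eq_domain[OF part \<Omega>(1) tiles]) measurable
    finally show ?thesis by simp
  qed
  ultimately have "(\<lambda>n. ennreal (\<integral>x. m n x - (m n x)\<^sup>2 \<partial>lebesgue)) \<longlonglongrightarrow> ennreal 0"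
    by simp
  then show ?thesis
    by (rule tendsto_ennrealD) (use sq in \<open>auto intro!: integral_nonneg_AE\<close>)
qed

text \<open>Against \<open>m n\<close> itself the character integrates to zero, and it has modulus one, so replacing
  \<open>m n\<close> by its square costs at most the integral of \<open>m n - (m n)\<^sup>2\<close>.\<close>
theorem integral_char_square_tendsto_0:
  fixes \<Lambda> :: "'i::{countable, ab_group_add} \<Rightarrow> 'a::euclidean_space"
    and m :: "nat \<Rightarrow> 'a \<Rightarrow> real" and a :: 'a
  assumes part: "\<And>n. lattice_partition \<Lambda> (m n)"
    and \<Omega>: "\<Omega> \<in> sets lebesgue" "emeasure lebesgue \<Omega> < \<infinity>"
    and tiles: "\<And>x. ((\<lambda>k. indicator \<Omega> (x + \<Lambda> k)) has_sum (1::real)) UNIV"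
    and peak: "AE x in lebesgue. x \<in> \<Omega> \<longrightarrow> (\<exists>k. (\<lambda>n. m n (x + \<Lambda> k)) \<longlonglongrightarrow> 1)"
    and a: "a \<noteq> 0"
    and dual: "\<And>k. \<exists>N::int. \<Lambda> k \<bullet> a = 2 * pi * of_int N"
  shows "(\<lambda>n. \<integral>x. exp (\<i> * of_real (x \<bullet> a)) * of_real ((m n x)\<^sup>2) \<partial>lebesgue) \<longlonglongrightarrow> 0"
proof (rule tendsto_norm_zero_cancel, rule real_tendsto_sandwich[OF _ _ tendsto_const])
  show "(\<lambda>n. \<integral>x. m n x - (m n x)\<^sup>2 \<partial>lebesgue) \<longlonglongrightarrow> 0"
    by (rule integral_defect_tendsto_0[OF part \<Omega> tiles peak])
  have [measurable]: "m n \<in> borel_measurable lebesgue" for n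
    by (rule lattice_partition.meas[OF part])
  have E [measurable]: "(\<lambda>x. exp (\<i> * of_real (x \<bullet> a))) \<in> borel_measurable lebesgue"
    by (rule measurable_completion)
       (simp add: borel_measurable_continuous_onI continuous_intros)
  have "norm (\<integral>x. exp (\<i> * of_real (x \<bullet> a)) * of_real ((m n x)\<^sup>2) \<partial>lebesgue)
      \<le> (\<integral>x. m n x - (m n x)\<^sup>2 \<partial>lebesgue)" for n
  proof -
    have nn: "0 \<le> m n x" "m n x \<le> 1" for x
      using lattice_partition.nonneg[OF part] lattice_partition.le_1[OF part] by auto
    have sq: "(m n x)\<^sup>2 \<le> m n x" for x
      using nn[of x] by (simp add: power2_eq_square mult_left_le)
    have int: "integrable lebesgue (m n)"
      by (rule lattice_partition.integrable[OF part \<Omega> tiles])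
    have int1: "integrable lebesgue (\<lambda>x. exp (\<i> * of_real (x \<bullet> a)) * of_real (m n x))"
      by (rule Bochner_Integration.integrable_bound[OF int]) (auto simp: norm_mult)
    have int2: "integrable lebesgue (\<lambda>x. exp (\<i> * of_real (x \<bullet> a)) * of_real ((m n x)\<^sup>2))"
      by (rule Bochner_Integration.integrable_bound[OF int]) (use sq nn in \<open>auto simp: norm_mult norm_power\<close>)
    have "(\<integral>x. exp (\<i> * of_real (x \<bullet> a)) * of_real (m n x) \<partial>lebesgue) = 0"
      by (rule lattice_partition.integral_char_eq_0[OF part int a dual])
    then have "norm (\<integral>x. exp (\<i> * of_real (x \<bullet> a)) * of_real ((m n x)\<^sup>2) \<partial>lebesgue)
      = norm (\<integral>x. exp (\<i> * of_real (x \<bullet> a)) * of_real (m n x)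
          - exp (\<i> * of_real (x \<bullet> a)) * of_real ((m n x)\<^sup>2) \<partial>lebesgue)"
      using int1 int2 by (subst Bochner_Integration.integral_diff) auto
    also have "\<dots> \<le> (\<integral>x. norm (exp (\<i> * of_real (x \<bullet> a)) * of_real (m n x)
          - exp (\<i> * of_real (x \<bullet> a)) * of_real ((m n x)\<^sup>2)) \<partial>lebesgue)"
      by (rule integral_norm_bound)
    also have "\<dots> = (\<integral>x. m n x - (m n x)\<^sup>2 \<partial>lebesgue)"
    proof (rule Bochner_Integration.integral_cong[OF refl])
      fix x
      have "exp (\<i> * of_real (x \<bullet> a)) * of_real (m n x) - exp (\<i> * of_real (x \<bullet> a)) * of_real ((m n x)\<^sup>2)
          = exp (\<i> * of_real (x \<bullet> a)) * of_real (m n x - (m n x)\<^sup>2)"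
        by (simp add: algebra_simps)
      then show "norm (exp (\<i> * of_real (x \<bullet> a)) * of_real (m n x)
          - exp (\<i> * of_real (x \<bullet> a)) * of_real ((m n x)\<^sup>2)) = m n x - (m n x)\<^sup>2"
        using sq[of x] by (simp only: norm_mult norm_of_real) simp
    qed
    finally show ?thesis .
  qed
  then show "\<forall>\<^sub>F n in sequentially. norm (\<integral>x. exp (\<i> * of_real (x \<bullet> a)) * of_real ((m n x)\<^sup>2) \<partial>lebesgue)
      \<le> (\<integral>x. m n x - (m n x)\<^sup>2 \<partial>lebesgue)"
    by (intro always_eventually allI)
qed (intro always_eventually allI norm_ge_zero)

section \<open>Dual lattices of the dilation matrix\<close>

lemma matrix_inv_right:
  fixes M :: "real^'d^'d"
  assumes "invertible M"
  shows "M ** matrix_inv M = mat 1"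
proof -
  have "\<exists>N. M ** N = mat 1 \<and> N ** M = mat 1"
    using assms by (simp only: invertible_def)
  then show ?thesis
    unfolding matrix_inv_def by (rule someI2_ex) blast
qed

text \<open>The powers \<open>M\<^sup>j\<close> and \<open>(M\<^sup>T)\<^sup>-\<^sup>j\<close> are contragredient, which makes \<open>freq_pt D j\<close> and
  \<open>space_pt D j\<close> parametrize dual lattices up to the factor \<open>2 \<pi>\<close>.\<close>
lemma inner_matrix_powi_dual:
  fixes M :: "real^'d^'d"
  assumes M: "invertible M"
  shows "(matrix_powi M j *v x) \<bullet> (matrix_powi (transpose M) (- j) *v y) = x \<bullet> y"
proof -
  have invT: "transpose N ** matrix_inv (transpose N) = mat 1" if inv: "invertible N" for N :: "real^'d^'d"
    using inv by (intro matrix_inv_right transpose_invertible)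
  have step: "(((**) P ^^ n) (mat 1) *v u) \<bullet> (((**) Q ^^ n) (mat 1) *v v) = u \<bullet> v"
    if PQ: "transpose P ** Q = mat 1" for P Q :: "real^'d^'d" and u v n
  proof (induction n)
    case (Suc n)
    have "(P *v z) \<bullet> (Q *v w) = z \<bullet> w" for z w
    proof -
      have "(P *v z) \<bullet> (Q *v w) = (z v* transpose P) \<bullet> (Q *v w)"
        by (simp only: vector_transpose_matrix)
      also have "\<dots> = z \<bullet> ((transpose P ** Q) *v w)"
        by (simp only: dot_lmul_matrix matrix_vector_mul_assoc)
      finally show ?thesis by (simp only: PQ matrix_vector_mul_lid)
    qed
    then show ?case
      using Suc by (simp add: matrix_vector_mul_assoc[symmetric])
  qed simp
  show ?thesis
  proof (cases "j \<ge> 0")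
    case True
    show ?thesis
    proof (cases "j = 0")
      case False
      then show ?thesis
        using True step[OF invT[OF M], of "nat j" x y] by (simp add: matrix_powi_def)
    qed (simp add: matrix_powi_def)
  next
    case False
    have "transpose (matrix_inv M) ** transpose M = mat 1"
      using matrix_inv_right[OF M] by (simp add: matrix_transpose_mul[symmetric] transpose_mat)
    from step[OF this, of "nat (- j)" x y] show ?thesis
      using False by (simp add: matrix_powi_def)
  qed
qed

lemma invertible_real_mat:
  assumes "scaled_orthogonal D"
  shows "invertible (real_mat D)"
proof -
  obtain a R where aR: "a > 1" "orthogonal_matrix R" "real_mat D = a *\<^sub>R R"
    using assms by (auto simp: scaled_orthogonal_def)
  show ?thesis
    unfolding invertible_def
    using aR
    by (intro exI[of _ "(1 / a) *\<^sub>R transpose R"])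
       (auto simp: orthogonal_matrix_def matrix_scalar_ac scalar_matrix_assoc)
qed

lemma inner_real_vec: "real_vec k \<bullet> real_vec l = of_int (\<Sum>i\<in>UNIV. k $ i * l $ i)"
  by (simp add: real_vec_def inner_vec_def)

lemma space_pt_inner_freq_pt:
  assumes "scaled_orthogonal D"
  shows "freq_pt D j l \<bullet> space_pt D j k = 2 * pi * of_int (\<Sum>i\<in>UNIV. k $ i * l $ i)"
  using inner_matrix_powi_dual[OF invertible_real_mat[OF assms], of j "real_vec k" "real_vec l"]
  by (simp only: space_pt_def freq_pt_def inner_real_vec inner_commute[of "_ *\<^sub>R _"] inner_scaleR_right)

text \<open>Pair \<open>D\<^sup>j k\<close> with the dual point of the same index.\<close>
lemma space_pt_nonzero:
  fixes k :: "int^'d"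
  assumes "scaled_orthogonal D" "k \<noteq> 0"
  shows "space_pt D j k \<noteq> 0"
proof
  assume "space_pt D j k = 0"
  then have "real_of_int (\<Sum>i\<in>UNIV. k $ i * k $ i) = 0"
    using space_pt_inner_freq_pt[OF assms(1), of j k k] by simp
  then have "real_vec k \<bullet> real_vec k = 0" by (simp only: inner_real_vec)
  then have "k = 0" by (simp add: real_vec_def vec_eq_iff)
  with assms show False by simp
qed

lemma freq_pt_add: "freq_pt D j (k + l) = freq_pt D j k + freq_pt D j l"
proof -
  have "real_vec (k + l) = real_vec k + real_vec l" by (simp add: real_vec_def vec_eq_iff)
  then show ?thesis
    by (simp add: freq_pt_def matrix_vector_right_distrib scaleR_right_distrib)
qed

section \<open>Concentration of the normalized B-spline symbols\<close>

lemma infsum_pos: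
  fixes s :: "'i \<Rightarrow> real"
  assumes "s summable_on UNIV" "\<And>i. 0 \<le> s i" "0 < s i0"
  shows "0 < infsum s UNIV"
proof -
  have "infsum s {i0} \<le> infsum s UNIV"
    using assms by (intro infsum_mono_neutral) auto
  then show ?thesis using assms(3) by simp
qed

text \<open>The denominator is a lattice sum, hence does not change under translation along the lattice.\<close>
lemma m_fun_translate:
  fixes D :: "int^'d^'d"
  shows "m_fun D j \<Phi> n (x + freq_pt D j l)
     = ((norm (\<Phi> (x + freq_pt D j l)))\<^sup>2) ^ n / (\<Sum>\<^sub>\<infinity>k. ((norm (\<Phi> (x + freq_pt D j k)))\<^sup>2) ^ n)"
proof -
  have "bij_betw (\<lambda>k. l + k) UNIV (UNIV :: (int^'d) set)"
    by (rule bij_betw_byWitness[where f' = "\<lambda>k. k - l"]) auto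
  then have "(\<Sum>\<^sub>\<infinity>k. ((norm (\<Phi> (x + freq_pt D j (l + k))))\<^sup>2) ^ n)
      = (\<Sum>\<^sub>\<infinity>k. ((norm (\<Phi> (x + freq_pt D j k)))\<^sup>2) ^ n)"
    by (rule infsum_reindex_bij_betw)
  then show ?thesis
    by (simp add: m_fun_def power_mult freq_pt_add add.assoc)
qed

lemma lattice_bounds_pos:
  assumes "lattice_bounds D j A B \<Phi> x" "0 < A"
  obtains k where "0 < (norm (\<Phi> (x + freq_pt D j k)))\<^sup>2"
proof -
  have "\<exists>k. \<Phi> (x + freq_pt D j k) \<noteq> 0"
  proof (rule ccontr)
    assume "\<not> ?thesis"
    then have "(\<Sum>\<^sub>\<infinity>k. (norm (\<Phi> (x + freq_pt D j k)))\<^sup>2) = 0"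
      by (intro infsum_0) auto
    then show False using assms by (simp add: lattice_bounds_def)
  qed
  then show ?thesis using that by auto
qed

lemma m_fun_partition:
  assumes bounds: "\<And>x. lattice_bounds D j A B \<Phi> x" and "0 < A"
  shows "((\<lambda>k. m_fun D j \<Phi> (Suc n) (x + freq_pt D j k)) has_sum 1) UNIV"
proof -
  define s where "s k = (norm (\<Phi> (x + freq_pt D j k)))\<^sup>2" for k
  have s: "s summable_on UNIV" and nonneg: "0 \<le> s k" for k
    using bounds[of x] by (auto simp: lattice_bounds_def s_def[abs_def])
  have sn: "(\<lambda>k. s k ^ Suc n) summable_on UNIV"
    using s nonneg by (intro summable_on_power) auto
  obtain k where "0 < s k" using lattice_bounds_pos[OF bounds \<open>0 < A\<close>] by (auto simp: s_def)
  then have pos: "0 < (\<Sum>\<^sub>\<infinity>k. s k ^ Suc n)"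
    using nonneg by (intro infsum_pos[OF sn, of k]) auto
  have "((\<lambda>k. s k ^ Suc n * inverse (\<Sum>\<^sub>\<infinity>k. s k ^ Suc n)) has_sum
      ((\<Sum>\<^sub>\<infinity>k. s k ^ Suc n) * inverse (\<Sum>\<^sub>\<infinity>k. s k ^ Suc n))) UNIV"
    by (rule has_sum_cmult_left) (rule has_sum_infsum[OF sn])
  then show ?thesis
    using pos unfolding m_fun_translate s_def[symmetric] by (simp add: divide_inverse)
qed

text \<open>The ordering of \<open>m_fun D j \<Phi> 1\<close> along an orbit is the ordering of \<open>\<bar>\<Phi>\<bar>\<^sup>2\<close>, since the
  denominators agree; the power \<open>n\<close> then singles out the strict maximum.\<close>
lemma m_fun_peak_tendsto_1:
  assumes bounds: "lattice_bounds D j A B \<Phi> y" and "0 < A"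
    and max: "\<And>k. k \<noteq> 0 \<Longrightarrow> m_fun D j \<Phi> 1 (y + freq_pt D j k) < m_fun D j \<Phi> 1 y"
  shows "(\<lambda>n. m_fun D j \<Phi> (Suc n) y) \<longlonglongrightarrow> 1"
proof -
  define s where "s k = (norm (\<Phi> (y + freq_pt D j k)))\<^sup>2" for k
  have s: "s summable_on UNIV" and nonneg: "0 \<le> s k" for k
    using bounds by (auto simp: lattice_bounds_def s_def[abs_def])
  have zero: "y + freq_pt D j 0 = y" using freq_pt_add[of D j 0 0] by simp
  obtain l where l: "0 < s l" using lattice_bounds_pos[OF bounds \<open>0 < A\<close>] by (auto simp: s_def)
  then have pos: "0 < infsum s UNIV"
    by (rule infsum_pos[OF s nonneg])
  have less: "s k < s 0" if "k \<noteq> 0" for k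
  proof -
    have "m_fun D j \<Phi> 1 (y + freq_pt D j k) < m_fun D j \<Phi> 1 (y + freq_pt D j 0)"
      using max[OF that] by (simp add: zero)
    then have "s k / infsum s UNIV < s 0 / infsum s UNIV"
      unfolding m_fun_translate s_def[symmetric] by simp
    then show ?thesis using pos by (simp add: divide_less_cancel)
  qed
  have "0 < s 0"
    using l less[of l] by (cases "l = 0") auto
  from normalized_power_tendsto_1[OF s nonneg less this]
  have "(\<lambda>n. m_fun D j \<Phi> (Suc n) (y + freq_pt D j 0)) \<longlonglongrightarrow> 1"
    unfolding m_fun_translate s_def[symmetric] .
  then show ?thesis by (simp add: zero)
qed

lemma m_fun_nonneg: "0 \<le> m_fun D j \<Phi> n x"
  by (auto simp: m_fun_def intro!: divide_nonneg_nonneg infsum_nonneg)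

section \<open>Asymptotic orthogonality of the translates\<close>

lemma admissible_symbol_nonzero:
  assumes "admissible_symbol L"
  shows "AE \<omega> in lebesgue. L \<omega> \<noteq> 0"
proof -
  obtain f g where null: "{\<omega>. f \<omega> * g \<omega> = 0} \<in> null_sets lebesgue"
    and L: "AE \<omega> in lebesgue. L \<omega> = f \<omega> / g \<omega>"
    using assms by (auto simp: admissible_symbol_def)
  from AE_not_in[OF null] L show ?thesis
    by eventually_elim auto
qed

text \<open>The weight \<open>\<bar>L\<bar>\<^sup>-\<^sup>2\<close> of the semi-inner product cancels the symbol that maps \<open>\<phi>\<close> to \<open>\<psi>\<close>, and the
  translation contributes a character.\<close>
lemma semi_inner_translate:
  fixes L :: "real^'d \<Rightarrow> complex"
  assumes L: "L \<in> borel_measurable lebesgue" "AE \<omega> in lebesgue. L \<omega> \<noteq> 0"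
    and \<phi>: "has_fourier \<phi> (\<lambda>\<omega>. of_real (u \<omega>))"
    and \<psi>: "multiplier_image (adjoint_symbol L) \<phi> \<psi>"
  shows "semi_inner L \<psi> (\<lambda>x. \<psi> (x - a))
       = (\<integral>\<omega>. exp (\<i> * of_real (\<omega> \<bullet> a)) * of_real ((u \<omega>)\<^sup>2) \<partial>lebesgue)"
proof -
  obtain F where F: "has_fourier \<phi> F" and \<psi>F: "has_fourier \<psi> (\<lambda>\<omega>. cnj (L \<omega>) * F \<omega>)"
    using \<psi> by (auto simp: multiplier_image_def adjoint_symbol_def)
  note \<psi>a = has_fourier_translate[OF \<psi>F, of a]
  have [measurable]: "L \<in> borel_measurable lebesgue" by fact
  have meas [measurable]: "fourier \<psi> \<in> borel_measurable lebesgue"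
      "fourier (\<lambda>x. \<psi> (x - a)) \<in> borel_measurable lebesgue"
    using has_fourier_fourier[OF \<psi>F] has_fourier_fourier[OF \<psi>a]
    by (auto simp: has_fourier_def sq_integrable_def)
  have [measurable]: "cnj \<in> borel_measurable borel"
    by (intro borel_measurable_continuous_onI continuous_intros)
  have u: "(\<lambda>\<omega>. complex_of_real (u \<omega>)) \<in> borel_measurable lebesgue"
    using \<phi> by (auto simp: has_fourier_def sq_integrable_def)
  have exp_wave: "exp (\<i> * of_real (\<omega> \<bullet> a)) = cnj (wave a \<omega>)" for \<omega>
    by (simp add: wave_def exp_cnj)
  have wave_meas: "(\<lambda>\<omega>. cnj (wave a \<omega>)) \<in> borel_measurable lebesgue"
    by (rule measurable_completion)
      (simp add: wave_def borel_measurable_continuous_onI continuous_intros)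
  show ?thesis
    unfolding semi_inner_def
  proof (rule integral_cong_AE)
    show "(\<lambda>\<omega>. fourier \<psi> \<omega> * cnj (fourier (\<lambda>x. \<psi> (x - a)) \<omega>) / of_real ((norm (L \<omega>))\<^sup>2))
        \<in> borel_measurable lebesgue"
      by measurable
    show "(\<lambda>\<omega>. exp (\<i> * of_real (\<omega> \<bullet> a)) * of_real ((u \<omega>)\<^sup>2)) \<in> borel_measurable lebesgue"
      unfolding exp_wave of_real_power
      by (intro borel_measurable_times borel_measurable_power wave_meas u)
    show "AE \<omega> in lebesgue. fourier \<psi> \<omega> * cnj (fourier (\<lambda>x. \<psi> (x - a)) \<omega>) / of_real ((norm (L \<omega>))\<^sup>2)
        = exp (\<i> * of_real (\<omega> \<bullet> a)) * of_real ((u \<omega>)\<^sup>2)"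
      using AE_fourier_eq[OF \<psi>F] AE_fourier_eq[OF \<psi>a] has_fourier_unique[OF F \<phi>] L(2)
    proof eventually_elim
      case (elim \<omega>)
      have "complex_of_real ((norm (L \<omega>))\<^sup>2) = L \<omega> * cnj (L \<omega>)"
        by (rule complex_norm_square)
      then show ?case
        using elim by (simp add: exp_wave power2_eq_square)
    qed
  qed
qed

theorem theorem4:
  fixes L :: "real ^ 'd \<Rightarrow> complex"
    and D :: "int ^ 'd ^ 'd"
    and r :: real
    and p :: "int \<Rightarrow> int ^ 'd \<Rightarrow> complex"
    and A B :: "int \<Rightarrow> real"
    and \<Phi> :: "int \<Rightarrow> real ^ 'd \<Rightarrow> complex"
    and \<phi> \<psi> :: "nat \<Rightarrow> int \<Rightarrow> real ^ 'd \<Rightarrow> complex"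
    and \<Omega> :: "int \<Rightarrow> (real ^ 'd) set"
    and j :: int
    and k :: "int ^ 'd"
  assumes "spline_admissible L D r"
    and "\<And>j. localization L D j (p j) (A j) (B j)"
    and "\<And>j. bspline_symbol L D j (p j) (A j) (B j) (\<Phi> j)"
    and "\<And>n j. n \<ge> 1 \<Longrightarrow>
           has_fourier (\<phi> n j)
             (\<lambda>\<omega>. of_real (\<bar>det (real_mat D)\<bar> powi j * m_fun D j (\<Phi> j) n \<omega>))"
    and "\<And>n j. n \<ge> 1 \<Longrightarrow>
           multiplier_image (adjoint_symbol (symbol_pow L n)) (\<phi> n j) (\<psi> n (j + 1))"
    and "\<And>j. fundamental_domain D j (\<Omega> j)"
    and "(\<Union>j. exceptional_set D j (\<Phi> j) (\<Omega> j)) \<in> null_sets lebesgue"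
    and "k \<noteq> 0"
  shows "(\<lambda>n. semi_inner (symbol_pow L n) (\<psi> n (j + 1))
            (\<lambda>x. \<psi> n (j + 1) (x - space_pt D j k))) \<longlonglongrightarrow> 0"
proof -
  define c where "c = \<bar>det (real_mat D)\<bar> powi j"
  define a where "a = space_pt D j k"
  define m where "m n = m_fun D j (\<Phi> j) (Suc n)" for n
  have D: "scaled_orthogonal D" and adm: "admissible_symbol L"
    using assms(1) by (auto simp: spline_admissible_def)
  have A: "0 < A j" using assms(2)[of j] by (simp add: localization_def)
  have bounds: "lattice_bounds D j (A j) (B j) (\<Phi> j) \<omega>" for \<omega>
    using assms(3)[of j] by (simp add: bspline_symbol_def)
  have \<phi>: "has_fourier (\<phi> (Suc n) j) (\<lambda>\<omega>. of_real (c * m n \<omega>))" for n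
    using assms(4)[of "Suc n" j] by (simp add: c_def m_def)
  have c: "c \<noteq> 0"
    using invertible_real_mat[OF D] by (simp add: c_def invertible_det_nz)
  have part: "lattice_partition (freq_pt D j) (m n)" for n
  proof
    show "m n \<in> borel_measurable lebesgue"
    proof -
      have "(\<lambda>\<omega>. complex_of_real (c * m n \<omega>)) \<in> borel_measurable lebesgue"
        using \<phi> by (simp add: has_fourier_def sq_integrable_def)
      \<comment> \<open>Measurability of \<open>m n\<close> comes from its being a Fourier transform up to the constant \<open>c\<close>.\<close>
      then have "(\<lambda>\<omega>. Re (complex_of_real (c * m n \<omega>)) / c) \<in> borel_measurable lebesgue"
        by measurable
      then show ?thesis using c by simp
    qed
  qed (use bounds A in \<open>auto simp: m_def freq_pt_add m_fun_nonneg intro: m_fun_partition\<close>)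
  have \<Omega>: "\<Omega> j \<in> sets lebesgue" "bounded (\<Omega> j)"
    and tiles: "((\<lambda>k. indicator (\<Omega> j) (x + freq_pt D j k)) has_sum (1::real)) UNIV" for x
    using assms(6)[of j] by (auto simp: fundamental_domain_def)
  have fin: "emeasure lebesgue (\<Omega> j) < \<infinity>"
    using bounded_set_imp_lmeasurable[OF \<Omega>(2,1)] by (auto simp: fmeasurable_def)
  have peak: "AE x in lebesgue. x \<in> \<Omega> j \<longrightarrow> (\<exists>k. (\<lambda>n. m n (x + freq_pt D j k)) \<longlonglongrightarrow> 1)"
    using AE_not_in[OF assms(7)]
  proof eventually_elim
    case (elim x)
    show ?case
    proof
      assume "x \<in> \<Omega> j"
      moreover have "x \<notin> exceptional_set D j (\<Phi> j) (\<Omega> j)" using elim by simp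
      ultimately obtain y where y: "y \<in> freq_orbit D j x"
        "\<And>k. k \<noteq> 0 \<Longrightarrow> m_fun D j (\<Phi> j) 1 (y + freq_pt D j k) < m_fun D j (\<Phi> j) 1 y"
        unfolding exceptional_set_def by blast
      then obtain l where "y = x + freq_pt D j l" by (auto simp: freq_orbit_def)
      with m_fun_peak_tendsto_1[OF bounds A y(2)]
      show "\<exists>k. (\<lambda>n. m n (x + freq_pt D j k)) \<longlonglongrightarrow> 1"
        by (auto simp: m_def)
    qed
  qed
  have "(\<lambda>n. \<integral>\<omega>. exp (\<i> * of_real (\<omega> \<bullet> a)) * of_real ((m n \<omega>)\<^sup>2) \<partial>lebesgue) \<longlonglongrightarrow> 0"
  proof (rule integral_char_square_tendsto_0[OF part \<Omega>(1) fin tiles peak])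
    show "a \<noteq> 0" unfolding a_def by (rule space_pt_nonzero[OF D assms(8)])
    show "\<exists>N. freq_pt D j l \<bullet> a = 2 * pi * of_int N" for l
      unfolding a_def space_pt_inner_freq_pt[OF D] by blast
  qed
  then have "(\<lambda>n. of_real (c\<^sup>2) * (\<integral>\<omega>. exp (\<i> * of_real (\<omega> \<bullet> a)) * of_real ((m n \<omega>)\<^sup>2) \<partial>lebesgue))
      \<longlonglongrightarrow> of_real (c\<^sup>2) * 0"
    by (rule tendsto_mult_left)
  moreover have "semi_inner (symbol_pow L (Suc n)) (\<psi> (Suc n) (j + 1)) (\<lambda>x. \<psi> (Suc n) (j + 1) (x - a))
      = of_real (c\<^sup>2) * (\<integral>\<omega>. exp (\<i> * of_real (\<omega> \<bullet> a)) * of_real ((m n \<omega>)\<^sup>2) \<partial>lebesgue)" for n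
  proof -
    have Lm [measurable]: "L \<in> borel_measurable lebesgue"
      using adm by (simp add: admissible_symbol_def)
    have "semi_inner (symbol_pow L (Suc n)) (\<psi> (Suc n) (j + 1)) (\<lambda>x. \<psi> (Suc n) (j + 1) (x - a))
        = (\<integral>\<omega>. exp (\<i> * of_real (\<omega> \<bullet> a)) * of_real ((c * m n \<omega>)\<^sup>2) \<partial>lebesgue)"
    proof (rule semi_inner_translate[OF _ _ \<phi> assms(5)])
      show "symbol_pow L (Suc n) \<in> borel_measurable lebesgue"
        unfolding symbol_pow_def by measurable
      show "AE \<omega> in lebesgue. symbol_pow L (Suc n) \<omega> \<noteq> 0"
        using admissible_symbol_nonzero[OF adm] by eventually_elim (simp add: symbol_pow_def)
    qed simp
    also have "\<dots> = (\<integral>\<omega>. of_real (c\<^sup>2) * (exp (\<i> * of_real (\<omega> \<bullet> a)) * of_real ((m n \<omega>)\<^sup>2)) \<partial>lebesgue)"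
      by (simp add: power_mult_distrib mult_ac)
    finally show ?thesis
      by (simp only: integral_mult_right_zero)
  qed
  \<comment> \<open>The hypotheses speak of \<open>n \<ge> 1\<close>; dropping the first term does not affect the limit.\<close>
  ultimately show ?thesis
    unfolding a_def[symmetric] by (subst filterlim_sequentially_Suc[symmetric]) simp
qed

end
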